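(* Let $P^F_c=P^F_d$, and assume that $$\tau_c\le p_c+\lambda_c-\sqrt{4N(p_c+2\lambda_c)\ln\left(\frac{1}{1-P^D_{\max}}\right)},$$ where $P^D_{\max}=\max\{P^D_1,\dots,P^D_N\}$. Then $P^D_c\ge P^D_d$.
   Context: Interconnected system: for $i\in\{1,\dots,N\}$, $x_i(k+1)=A_{ii}x_i(k)+B_iu_i(k)+B^a_iu^a_i(k)+w_i(k)$, $y_i(k)=C_ix_i(k)+v_i(k)$, where $B_i=[A_{i1}\ \cdots\ A_{i,i-1}\ A_{i,i+1}\ \cdots\ A_{iN}]$ and $u_i=[x_1^{\mathsf T}\ \cdots\ x_{i-1}^{\mathsf T}\ x_{i+1}^{\mathsf T}\ \cdots\ x_N^{\mathsf T}]^{\mathsf T}$. The noises $w_i(k)\sim\mathcal N(0,\Sigma_{w_i})$ and $v_i(k)\sim\mathcal N(0,\Sigma_{v_i})$ are independent over time, of each other, and across subsystems. The initial state and the attack $u^a_i$ are deterministic. Stacking the subsystems: $x(k+1)=Ax(k)+B^au^a(k)+w(k)$, $y(k)=Cx(k)+v(k)$, with $A=[A_{ij}]_{i,j=1}^N$, $B^a=\mathrm{blkdiag}(B^a_1,\dots,B^a_N)$, $C=\mathrm{blkdiag}(C_1,\dots,C_N)$, $\Sigma_w=\mathrm{blkdiag}(\Sigma_{w_1},\dots,\Sigma_{w_N})$, $\Sigma_v=\mathrm{blkdiag}(\Sigma_{v_1},\dots,\Sigma_{v_N})$. Fix a horizon $T>0$. Let $Y_i=[y_i(1)^{\mathsf T}\cdots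 y_i(T)^{\mathsf T}]^{\mathsf T}$, $Y_c=[y(1)^{\mathsf T}\cdots y(T)^{\mathsf T}]^{\mathsf T}$; $U^a_i=[u^a_i(0)^{\mathsf T}\cdots u^a_i(T-1)^{\mathsf T}]^{\mathsf T}$, $U^a=[u^a(0)^{\mathsf T}\cdots u^a(T-1)^{\mathsf T}]^{\mathsf T}$. Define $\mathcal O_i=[(C_iA_{ii})^{\mathsf T}\cdots(C_iA_{ii}^T)^{\mathsf T}]^{\mathsf T}$, and let $\mathcal F^{(a)}_i,\mathcal F^{(u)}_i,\mathcal F^{(w)}_i$ be the $T\times T$ block matrices whose $(j,l)$ block is, for $j\ge l$, $C_iA_{ii}^{j-l}B^a_i$, $C_iA_{ii}^{j-l}B_i$, $C_iA_{ii}^{j-l}$ respectively, and $0$ for $j<l$. Let $\mathcal O_c,\mathcal F^{(a)}_c,\mathcal F^{(w)}_c$ be defined as $\mathcal O_i,\mathcal F^{(a)}_i,\mathcal F^{(w)}_i$ with $A_{ii},B^a_i,C_i$ replaced by $A,B^a,C$. Let the rows of $N_i$ form a basis of the left null space of $[\mathcal O_i\ \ \mathcal F^{(u)}_i]$ and the rows of $N_c$ a basis of the left null space of $\mathcal O_c$ (these null spaces are nontrivial). Set $\widetilde Y_i=N_iY_i$, $\widetilde Y_c=N_cY_c$, which are Gaussian with means $\beta_i=N_i\mathcal F^{(a)}_iU^a_i$, $\beta_c=N_c\mathcal F^{(a)}_cU^a$ and covariances $\Sigma_i=N_i[\mathcal F^{(w)}_i(I_T\otimes\Sigma_{w_i})(\mathcal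 F^{(w)}_i)^{\mathsf T}+(I_T\otimes\Sigma_{v_i})]N_i^{\mathsf T}$, $\Sigma_c=N_c[\mathcal F^{(w)}_c(I_T\otimes\Sigma_w)(\mathcal F^{(w)}_c)^{\mathsf T}+(I_T\otimes\Sigma_v)]N_c^{\mathsf T}$, assumed invertible. Set $p_i=\mathrm{Rank}(\Sigma_i)$, $p_c=\mathrm{Rank}(\Sigma_c)$, $\lambda_i=\beta_i^{\mathsf T}\Sigma_i^{-1}\beta_i$, $\lambda_c=\beta_c^{\mathsf T}\Sigma_c^{-1}\beta_c$. Detectors: with thresholds $\tau_i,\tau_c\ge0$, the $i$-th local detector raises an alarm if $\Lambda_i:=\widetilde Y_i^{\mathsf T}\Sigma_i^{-1}\widetilde Y_i\ge\tau_i$; the centralized detector raises an alarm if $\Lambda_c:=\widetilde Y_c^{\mathsf T}\Sigma_c^{-1}\widetilde Y_c\ge\tau_c$; the decentralized detector raises an alarm if at least one local detector does. $H_0$: no attack (means equal to zero). $H_1$: the system is under the fixed deterministic attack $U^a$. False alarm and detection probabilities are the alarm probabilities under $H_0$ and $H_1$ respectively: $P^F_i=\Pr[\Lambda_i\ge\tau_i|H_0]=Q(\tau_i;p_i,0)$, $P^D_i=\Pr[\Lambda_i\ge\tau_i|H_1]=Q(\tau_i;p_i,\lambda_i)$, $P^F_c=\Pr[\Lambda_c\ge\tau_c|H_0]=Q(\tau_c;p_c,0)$, $P^D_c=\Pr[\Lambda_c\ge\tau_c|H_1]=Q(\tau_c;p_c,\lambda_c)$, $P^F_d=\Pr[\Lambda_i\ge\tau_i\text{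 for some }i|H_0]$, $P^D_d=\Pr[\Lambda_i\ge\tau_i\text{ for some }i|H_1]$. Here $Q(\tau;p,\lambda)$ is the complementary cumulative distribution function at $\tau$ of the noncentral chi-squared distribution with $p$ degrees of freedom and noncentrality parameter $\lambda$. Convention: $\ln(1/0)=+\infty$ (so the displayed condition on $\tau_c$ fails if $P^D_{\max}=1$). *)

theory Defs
  imports
    "HOL-Probability.Probability"
    "Jordan_Normal_Form.Matrix_Kernel"
    "Jordan_Normal_Form.DL_Rank"
begin

unbundle no inner_syntax
unbundle no vec_syntax
hide_type (open) Finite_Cartesian_Product.vec
hide_const (open) Finite_Cartesian_Product.vec Finite_Cartesian_Product.mat
  Finite_Cartesian_Product.row Determinants.det Cartesian_Space.rank

section \<open>Matrices\<close>

definition vcat :: "nat \<Rightarrow> real mat list \<Rightarrow> real mat" where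
  "vcat nc Ms = mat_of_rows nc (concat (map rows Ms))"

definition hcat :: "nat \<Rightarrow> real mat list \<Rightarrow> real mat" where
  "hcat nr Ms = mat_of_cols nr (concat (map cols Ms))"

definition stack :: "real vec list \<Rightarrow> real vec" where
  "stack vs = foldr (@\<^sub>v) vs (0\<^sub>v 0)"

definition left_null_space :: "real mat \<Rightarrow> real vec set" where
  "left_null_space M = mat_kernel (transpose_mat M)"

definition rows_basis_of_left_null_space :: "real mat \<Rightarrow> real mat \<Rightarrow> bool" where
  "rows_basis_of_left_null_space K M \<longleftrightarrow>
     dim_col K = dim_row M \<and> distinct (rows K) \<and>
     kernel.basis (dim_row M) (transpose_mat M) (set (rows K))"

text \<open>The quadratic form of the inverse of \<open>S\<close>; only used for invertible \<open>S\<close>.\<close>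

definition inv_quad_form :: "real mat \<Rightarrow> real vec \<Rightarrow> real" where
  "inv_quad_form S z = z \<bullet> (the (mat_inverse S) *\<^sub>v z)"

definition covariance_mat :: "nat \<Rightarrow> real mat \<Rightarrow> bool" where
  "covariance_mat d S \<longleftrightarrow> S \<in> carrier_mat d d \<and> transpose_mat S = S \<and>
     (\<forall>a\<in>carrier_vec d. 0 \<le> a \<bullet> (S *\<^sub>v a))"

section \<open>Gaussian random vectors\<close>

text \<open>The normal law with the given mean and variance; a point mass if the variance is 0.\<close>

definition normal_law :: "real \<Rightarrow> real \<Rightarrow> real measure" where
  "normal_law \<mu> s = (if s = 0 then return borel \<mu> else density lborel (normal_density \<mu> (sqrt s)))"

text \<open>A random vector is Gaussian if all its linear functionals are Gaussian. Unlike the definition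
  by a density, this admits singular covariance matrices.\<close>

definition gaussian_vec :: "'o measure \<Rightarrow> nat \<Rightarrow> ('o \<Rightarrow> real vec) \<Rightarrow> real vec \<Rightarrow> real mat \<Rightarrow> bool" where
  "gaussian_vec M d X \<mu> S \<longleftrightarrow>
     (\<forall>\<omega>\<in>space M. X \<omega> \<in> carrier_vec d) \<and>
     (\<forall>a\<in>carrier_vec d.
        (\<lambda>\<omega>. a \<bullet> X \<omega>) \<in> borel_measurable M \<and>
        distr M borel (\<lambda>\<omega>. a \<bullet> X \<omega>) = normal_law (a \<bullet> \<mu>) (a \<bullet> (S *\<^sub>v a)))"

text \<open>Mutual independence of random vectors of various dimensions; the type of vectors of arbitrary
  dimension carries no sigma-algebra, so vectors are identified with their coordinate functions.\<close>

definition indep_vecs :: "'o measure \<Rightarrow> ('q \<Rightarrow> nat) \<Rightarrow> ('q \<Rightarrow> 'o \<Rightarrow> real vec) \<Rightarrow> 'q set \<Rightarrow> bool" where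
  "indep_vecs M d X Q \<longleftrightarrow>
     prob_space.indep_vars M (\<lambda>q. PiM {..<d q} (\<lambda>_. borel))
       (\<lambda>q \<omega>. \<lambda>j\<in>{..<d q}. X q \<omega> $ j) Q"

section \<open>The interconnected system\<close>

text \<open>Subsystems are numbered from 1 to \<open>nsub\<close>. In \<open>wnoise i k\<close>, \<open>vnoise i k\<close> and in attacks,
  \<open>i\<close> is the subsystem and \<open>k\<close> the time.\<close>

record 'o network =
  nsub :: nat
  xdim :: "nat \<Rightarrow> nat"
  ydim :: "nat \<Rightarrow> nat"
  adim :: "nat \<Rightarrow> nat"
  Amat :: "nat \<Rightarrow> nat \<Rightarrow> real mat"
  Bamat :: "nat \<Rightarrow> real mat"
  Cmat :: "nat \<Rightarrow> real mat"
  wcov :: "nat \<Rightarrow> real mat"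
  vcov :: "nat \<Rightarrow> real mat"
  xinit :: "nat \<Rightarrow> real vec"
  pspace :: "'o measure"
  wnoise :: "nat \<Rightarrow> nat \<Rightarrow> 'o \<Rightarrow> real vec"
  vnoise :: "nat \<Rightarrow> nat \<Rightarrow> 'o \<Rightarrow> real vec"

type_synonym attack = "nat \<Rightarrow> nat \<Rightarrow> real vec"

definition subs :: "'o network \<Rightarrow> nat list" where
  "subs S = [1..<Suc (nsub S)]"

definition interconnected_system :: "'o network \<Rightarrow> bool" where
  "interconnected_system S \<longleftrightarrow>
     0 < nsub S \<and>
     (\<forall>i\<in>{1..nsub S}.
        (\<forall>j\<in>{1..nsub S}. Amat S i j \<in> carrier_mat (xdim S i) (xdim S j)) \<and>
        Bamat S i \<in> carrier_mat (xdim S i) (adim S i) \<and>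
        Cmat S i \<in> carrier_mat (ydim S i) (xdim S i) \<and>
        xinit S i \<in> carrier_vec (xdim S i) \<and>
        covariance_mat (xdim S i) (wcov S i) \<and>
        covariance_mat (ydim S i) (vcov S i)) \<and>
     prob_space (pspace S) \<and>
     (\<forall>i\<in>{1..nsub S}. \<forall>k.
        gaussian_vec (pspace S) (xdim S i) (wnoise S i k) (0\<^sub>v (xdim S i)) (wcov S i) \<and>
        gaussian_vec (pspace S) (ydim S i) (vnoise S i k) (0\<^sub>v (ydim S i)) (vcov S i)) \<and>
     indep_vecs (pspace S)
       (case_sum (\<lambda>(i, k). xdim S i) (\<lambda>(i, k). ydim S i))
       (case_sum (\<lambda>(i, k). wnoise S i k) (\<lambda>(i, k). vnoise S i k))
       (({1..nsub S} \<times> UNIV) <+> ({1..nsub S} \<times> UNIV))"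

definition is_attack :: "'o network \<Rightarrow> attack \<Rightarrow> bool" where
  "is_attack S ua \<longleftrightarrow> (\<forall>i\<in>{1..nsub S}. \<forall>k. ua i k \<in> carrier_vec (adim S i))"

definition no_attack :: "'o network \<Rightarrow> attack" where
  "no_attack S i k = 0\<^sub>v (adim S i)"

definition others :: "'o network \<Rightarrow> nat \<Rightarrow> nat list" where
  "others S i = filter (\<lambda>j. j \<noteq> i) (subs S)"

definition Bmat :: "'o network \<Rightarrow> nat \<Rightarrow> real mat" where
  "Bmat S i = hcat (xdim S i) (map (Amat S i) (others S i))"

primrec state :: "'o network \<Rightarrow> attack \<Rightarrow> 'o \<Rightarrow> nat \<Rightarrow> nat \<Rightarrow> real vec" where
  "state S ua \<omega> 0 = xinit S"
| "state S ua \<omega> (Suc k) = (\<lambda>i.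
     Amat S i i *\<^sub>v state S ua \<omega> k i
     + Bmat S i *\<^sub>v stack (map (state S ua \<omega> k) (others S i))
     + Bamat S i *\<^sub>v ua i k + wnoise S i k \<omega>)"

definition measurement :: "'o network \<Rightarrow> attack \<Rightarrow> 'o \<Rightarrow> nat \<Rightarrow> nat \<Rightarrow> real vec" where
  "measurement S ua \<omega> k i = Cmat S i *\<^sub>v state S ua \<omega> k i + vnoise S i k \<omega>"

definition Ac :: "'o network \<Rightarrow> real mat" where
  "Ac S = vcat (sum_list (map (xdim S) (subs S)))
     (map (\<lambda>i. hcat (xdim S i) (map (Amat S i) (subs S))) (subs S))"

definition Bac :: "'o network \<Rightarrow> real mat" where
  "Bac S = diag_block_mat (map (Bamat S) (subs S))"

definition Cc :: "'o network \<Rightarrow> real mat" where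
  "Cc S = diag_block_mat (map (Cmat S) (subs S))"

definition wcovc :: "'o network \<Rightarrow> real mat" where
  "wcovc S = diag_block_mat (map (wcov S) (subs S))"

definition vcovc :: "'o network \<Rightarrow> real mat" where
  "vcovc S = diag_block_mat (map (vcov S) (subs S))"

section \<open>Measurements over the horizon\<close>

definition Yl :: "'o network \<Rightarrow> nat \<Rightarrow> attack \<Rightarrow> nat \<Rightarrow> 'o \<Rightarrow> real vec" where
  "Yl S T ua i \<omega> = stack (map (\<lambda>k. measurement S ua \<omega> k i) [1..<Suc T])"

definition Yc :: "'o network \<Rightarrow> nat \<Rightarrow> attack \<Rightarrow> 'o \<Rightarrow> real vec" where
  "Yc S T ua \<omega> = stack (map (\<lambda>k. stack (map (measurement S ua \<omega> k) (subs S))) [1..<Suc T])"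

definition Uc :: "'o network \<Rightarrow> nat \<Rightarrow> attack \<Rightarrow> real vec" where
  "Uc S T ua = stack (map (\<lambda>k. stack (map (\<lambda>i. ua i k) (subs S))) [0..<T])"

definition obs_mat :: "nat \<Rightarrow> real mat \<Rightarrow> real mat \<Rightarrow> real mat" where
  "obs_mat T A C = vcat (dim_col A) (map (\<lambda>j. C * A ^\<^sub>m j) [1..<Suc T])"

text \<open>The block lower triangular Toeplitz matrix whose \<open>(j, l)\<close> block is \<open>G (j - l)\<close> for \<open>j \<ge> l\<close>;
  all blocks \<open>G k\<close> are of size \<open>p\<close> by \<open>q\<close>.\<close>

definition toeplitz :: "nat \<Rightarrow> nat \<Rightarrow> nat \<Rightarrow> (nat \<Rightarrow> real mat) \<Rightarrow> real mat" where
  "toeplitz T p q G = vcat (T * q)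
     (map (\<lambda>j. hcat p (map (\<lambda>l. if l \<le> j then G (j - l) else 0\<^sub>m p q) [1..<Suc T])) [1..<Suc T])"

definition force_mat :: "nat \<Rightarrow> real mat \<Rightarrow> real mat \<Rightarrow> real mat \<Rightarrow> real mat" where
  "force_mat T A C B = toeplitz T (dim_row C) (dim_col B) (\<lambda>k. C * A ^\<^sub>m k * B)"

definition noise_mat :: "nat \<Rightarrow> real mat \<Rightarrow> real mat \<Rightarrow> real mat" where
  "noise_mat T A C = toeplitz T (dim_row C) (dim_col A) (\<lambda>k. C * A ^\<^sub>m k)"

definition OFl :: "'o network \<Rightarrow> nat \<Rightarrow> nat \<Rightarrow> real mat" where
  "OFl S T i = hcat (T * ydim S i)
     [obs_mat T (Amat S i i) (Cmat S i), force_mat T (Amat S i i) (Cmat S i) (Bmat S i)]"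

definition Oc :: "'o network \<Rightarrow> nat \<Rightarrow> real mat" where
  "Oc S T = obs_mat T (Ac S) (Cc S)"

text \<open>\<open>diag_block_mat (replicate T P)\<close> is the Kronecker product of the identity of size \<open>T\<close>
  with \<open>P\<close>.\<close>

definition filtered_cov :: "nat \<Rightarrow> real mat \<Rightarrow> real mat \<Rightarrow> real mat \<Rightarrow> real mat \<Rightarrow> real mat" where
  "filtered_cov T K F P R =
     K * (F * diag_block_mat (replicate T P) * transpose_mat F + diag_block_mat (replicate T R))
       * transpose_mat K"

definition Sigmal :: "'o network \<Rightarrow> nat \<Rightarrow> (nat \<Rightarrow> real mat) \<Rightarrow> nat \<Rightarrow> real mat" where
  "Sigmal S T Nl i =
     filtered_cov T (Nl i) (noise_mat T (Amat S i i) (Cmat S i)) (wcov S i) (vcov S i)"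

definition Sigmac :: "'o network \<Rightarrow> nat \<Rightarrow> real mat \<Rightarrow> real mat" where
  "Sigmac S T Nc = filtered_cov T Nc (noise_mat T (Ac S) (Cc S)) (wcovc S) (vcovc S)"

definition pc :: "'o network \<Rightarrow> nat \<Rightarrow> real mat \<Rightarrow> nat" where
  "pc S T Nc = vec_space.rank (dim_row (Sigmac S T Nc)) (Sigmac S T Nc)"

definition betac :: "'o network \<Rightarrow> nat \<Rightarrow> real mat \<Rightarrow> attack \<Rightarrow> real vec" where
  "betac S T Nc ua = Nc *\<^sub>v (force_mat T (Ac S) (Cc S) (Bac S) *\<^sub>v Uc S T ua)"

definition lambdac :: "'o network \<Rightarrow> nat \<Rightarrow> real mat \<Rightarrow> attack \<Rightarrow> real" where
  "lambdac S T Nc ua = inv_quad_form (Sigmac S T Nc) (betac S T Nc ua)"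

section \<open>Detectors\<close>

definition Lambdal :: "'o network \<Rightarrow> nat \<Rightarrow> (nat \<Rightarrow> real mat) \<Rightarrow> attack \<Rightarrow> nat \<Rightarrow> 'o \<Rightarrow> real" where
  "Lambdal S T Nl ua i \<omega> = inv_quad_form (Sigmal S T Nl i) (Nl i *\<^sub>v Yl S T ua i \<omega>)"

definition Lambdac :: "'o network \<Rightarrow> nat \<Rightarrow> real mat \<Rightarrow> attack \<Rightarrow> 'o \<Rightarrow> real" where
  "Lambdac S T Nc ua \<omega> = inv_quad_form (Sigmac S T Nc) (Nc *\<^sub>v Yc S T ua \<omega>)"

text \<open>Alarm probabilities under the attack \<open>ua\<close>: false alarm probabilities for
  \<open>ua = no_attack S\<close>, detection probabilities for the actual attack.\<close>

definition alarm_prob_local ::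
  "'o network \<Rightarrow> nat \<Rightarrow> (nat \<Rightarrow> real mat) \<Rightarrow> (nat \<Rightarrow> real) \<Rightarrow> attack \<Rightarrow> nat \<Rightarrow> real" where
  "alarm_prob_local S T Nl \<tau> ua i =
     measure (pspace S) {\<omega> \<in> space (pspace S). Lambdal S T Nl ua i \<omega> \<ge> \<tau> i}"

definition alarm_prob_central ::
  "'o network \<Rightarrow> nat \<Rightarrow> real mat \<Rightarrow> real \<Rightarrow> attack \<Rightarrow> real" where
  "alarm_prob_central S T Nc \<tau>c ua =
     measure (pspace S) {\<omega> \<in> space (pspace S). Lambdac S T Nc ua \<omega> \<ge> \<tau>c}"

definition alarm_prob_decentral ::
  "'o network \<Rightarrow> nat \<Rightarrow> (nat \<Rightarrow> real mat) \<Rightarrow> (nat \<Rightarrow> real) \<Rightarrow> attack \<Rightarrow> real" where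
  "alarm_prob_decentral S T Nl \<tau> ua =
     measure (pspace S)
       {\<omega> \<in> space (pspace S). \<exists>i\<in>{1..nsub S}. Lambdal S T Nl ua i \<omega> \<ge> \<tau> i}"

end

theory Submission
  imports Defs
begin

text \<open>
  Each local filter removes not only the initial state of its subsystem but also the signals that it receives
  from the other subsystems. A local statistic is therefore a function of the noise of its own subsystem
  (\<open>filtered_local_output\<close>), and the local statistics are independent although the subsystems interact
  (\<open>local_statistics_indep\<close>). Hence the decentralized detector misses the attack with probability
  \<open>\<Prod>i. 1 - P i \<ge> (1 - PDmax) ^ N = exp (- x)\<close>, where \<open>P i\<close> is the detection probability of the \<open>i\<close>-th local
  detector and \<open>x = N ln (1 / (1 - PDmax))\<close>. It remains to see that the centralized detector misses it with probability
  at most \<open>exp (- x)\<close> (\<open>central_miss_prob\<close>).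

  The central statistic has a noncentral chi-squared law with \<open>p\<close> degrees of freedom and noncentrality \<open>\<lambda>\<close>, and the
  condition on the threshold reads \<open>\<tau> \<le> p + \<lambda> - 2 \<surd>((p + 2 \<lambda>) x)\<close>. Below this level the law has mass at most
  \<open>exp (- x)\<close>, by Chernoff's method (\<open>noncentral_chi_square_lower_tail\<close>). The Laplace transform that this needs is
  obtained from characteristic functions (\<open>laplace_sum_squares\<close>): \<open>exp (- t |y|\<^sup>2)\<close> is itself an average of the
  characters \<open>exp (i \<surd>(2 t) (g \<bullet> y))\<close> over a standard Gaussian vector \<open>g\<close>. So all that has to be known about the
  filtered central measurements are the characteristic functions of their linear functionals, and each such functional
  is a sum of independent normal variables (\<open>cf_sum_indep_gaussian\<close>, \<open>central_functional\<close>).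
\<close>

section \<open>Stacked vectors and block matrices\<close>

lemma stack_simps [simp]:
  "stack [] = 0\<^sub>v 0"
  "stack (v # vs) = v @\<^sub>v stack vs"
  by (simp_all add: stack_def)

lemma stack_carrier:
  assumes "\<And>x. x \<in> set xs \<Longrightarrow> f x \<in> carrier_vec (d x)"
  shows "stack (map f xs) \<in> carrier_vec (sum_list (map d xs))"
  using assms by (induction xs) auto

lemma stack_add:
  assumes "\<And>x. x \<in> set xs \<Longrightarrow> f x \<in> carrier_vec (d x)" "\<And>x. x \<in> set xs \<Longrightarrow> g x \<in> carrier_vec (d x)"
  shows "stack (map f xs) + stack (map g xs) = stack (map (\<lambda>x. f x + g x) xs)"
  using assms
proof (induction xs)
  case (Cons x xs)
  show ?case
    using Cons
    by (simp add: append_vec_add[of _ "d x" _ _ "sum_list (map d xs)"] stack_carrier)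
qed auto

lemma stack_scalar_prod:
  assumes "\<And>x. x \<in> set xs \<Longrightarrow> f x \<in> carrier_vec (d x)" "\<And>x. x \<in> set xs \<Longrightarrow> g x \<in> carrier_vec (d x)"
  shows "stack (map f xs) \<bullet> stack (map g xs) = (\<Sum>x\<leftarrow>xs. f x \<bullet> g x)"
  using assms
proof (induction xs)
  case (Cons x xs)
  show ?case
    using Cons
    by (simp add: scalar_prod_append[of _ "d x" _ "sum_list (map d xs)"] stack_carrier)
qed auto

text \<open>Blocks of a given vector, so that statements about arbitrary vectors of stacked dimension reduce to
  statements about stacks. The index list must be distinct for the blocks to be a function of the index.\<close>

lemma stack_decompose:
  assumes "distinct xs" "v \<in> carrier_vec (sum_list (map d xs))"
  obtains f where "\<forall>x\<in>set xs. f x \<in> carrier_vec (d x)" "v = stack (map f xs)"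
proof -
  have "\<exists>f. (\<forall>x\<in>set xs. f x \<in> carrier_vec (d x)) \<and> v = stack (map f xs)"
    using assms
  proof (induction xs arbitrary: v)
    case (Cons x xs)
    let ?n = "sum_list (map d xs)"
    have v: "vec_first v (d x) @\<^sub>v vec_last v ?n = v"
      using Cons.prems by simp
    obtain f where f: "\<forall>x\<in>set xs. f x \<in> carrier_vec (d x)" "vec_last v ?n = stack (map f xs)"
      using Cons.IH[of "vec_last v ?n"] Cons.prems by auto
    have "map (f(x := vec_first v (d x))) xs = map f xs"
      using Cons.prems by auto
    then show ?case
      using f v Cons.prems by (intro exI[of _ "f(x := vec_first v (d x))"]) (auto simp del: fun_upd_apply simp: fun_upd_same fun_upd_other)
  qed auto
  then show ?thesis using that by blast
qed

lemma hcat_carrier: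
  assumes "\<And>x. x \<in> set xs \<Longrightarrow> D x \<in> carrier_mat nr (d x)"
  shows "hcat nr (map D xs) \<in> carrier_mat nr (sum_list (map d xs))"
proof -
  have "length (concat (map cols (map D xs))) = sum_list (map d xs)"
    using assms by (induction xs) auto
  then show ?thesis unfolding hcat_def by (metis mat_of_cols_carrier(1))
qed

lemma vcat_carrier:
  assumes "\<And>x. x \<in> set xs \<Longrightarrow> D x \<in> carrier_mat (e x) nc"
  shows "vcat nc (map D xs) \<in> carrier_mat (sum_list (map e xs)) nc"
proof -
  have "length (concat (map rows (map D xs))) = sum_list (map e xs)"
    using assms by (induction xs) auto
  then show ?thesis unfolding vcat_def by (metis mat_of_rows_carrier(1))
qed

text \<open>Stated by entries, so that the right-hand side can be reordered as an ordinary sum: the central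
  state matrix sums over all subsystems, a local model over all other subsystems.\<close>

lemma hcat_mult_stack:
  assumes "\<And>x. x \<in> set xs \<Longrightarrow> D x \<in> carrier_mat nr (d x)"
    and "\<And>x. x \<in> set xs \<Longrightarrow> f x \<in> carrier_vec (d x)" and r: "r < nr"
  shows "(hcat nr (map D xs) *\<^sub>v stack (map f xs)) $ r = (\<Sum>x\<leftarrow>xs. (D x *\<^sub>v f x) $ r)"
  using assms(1,2)
proof (induction xs)
  case Nil
  then show ?case using r by (simp add: hcat_def scalar_prod_def)
next
  case (Cons x xs)
  let ?H = "hcat nr (map D xs)" and ?n = "sum_list (map d xs)"
  have H: "?H \<in> carrier_mat nr ?n" using Cons.prems by (intro hcat_carrier) auto
  have H': "hcat nr (map D (x # xs)) \<in> carrier_mat nr (d x + ?n)"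
    using hcat_carrier[of "x # xs" D nr d] Cons.prems by auto
  have Dx: "D x \<in> carrier_mat nr (d x)" using Cons.prems by simp
  have len: "length (concat (map cols (map D xs))) = ?n"
    using H unfolding hcat_def by (metis carrier_matD(2) mat_of_cols_carrier(3))
  have "row (hcat nr (map D (x # xs))) r = row (D x) r @\<^sub>v row ?H r"
  proof (rule eq_vecI)
    fix j assume "j < dim_vec (row (D x) r @\<^sub>v row ?H r)"
    then have j: "j < d x + ?n" using Dx H by simp
    show "row (hcat nr (map D (x # xs))) r $ j = (row (D x) r @\<^sub>v row ?H r) $ j"
      using j r Dx H H' len
      by (auto simp: hcat_def mat_of_cols_index nth_append)
  qed (use Dx H H' in auto)
  moreover have "stack (map f xs) \<in> carrier_vec ?n"
    using Cons.prems by (intro stack_carrier) auto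
  ultimately show ?case
    using Cons H H' r carrier_matD[OF Dx] row_carrier_vec[OF _ Dx, of r]
    by (simp add: scalar_prod_append[of _ "d x" _ ?n])
qed

lemma hcat_pair_mult:
  assumes A: "A \<in> carrier_mat nr n1" and B: "B \<in> carrier_mat nr n2"
    and a: "a \<in> carrier_vec n1" and b: "b \<in> carrier_vec n2"
  shows "hcat nr [A, B] \<in> carrier_mat nr (n1 + n2)"
    and "hcat nr [A, B] *\<^sub>v (a @\<^sub>v b) = A *\<^sub>v a + B *\<^sub>v b"
proof -
  let ?D = "\<lambda>x. if x then A else B" and ?d = "\<lambda>x. if x then n1 else n2" and ?f = "\<lambda>x. if x then a else b"
  show H: "hcat nr [A, B] \<in> carrier_mat nr (n1 + n2)"
    using hcat_carrier[of "[True, False]" ?D nr ?d] A B by auto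
  have "b @\<^sub>v 0\<^sub>v 0 = b" by (rule eq_vecI) auto
  then show "hcat nr [A, B] *\<^sub>v (a @\<^sub>v b) = A *\<^sub>v a + B *\<^sub>v b"
    using hcat_mult_stack[of "[True, False]" ?D nr ?d ?f] A B a b H by (intro eq_vecI) auto
qed

lemma vcat_mult_vec:
  assumes "\<And>x. x \<in> set xs \<Longrightarrow> D x \<in> carrier_mat (e x) nc" and z: "z \<in> carrier_vec nc"
  shows "vcat nc (map D xs) *\<^sub>v z = stack (map (\<lambda>x. D x *\<^sub>v z) xs)"
  using assms(1)
proof (induction xs)
  case Nil
  then show ?case by (auto simp: vcat_def)
next
  case (Cons x xs)
  let ?H = "vcat nc (map D xs)" and ?n = "sum_list (map e xs)"
  have H: "?H \<in> carrier_mat ?n nc" using Cons.prems by (intro vcat_carrier) auto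
  have H': "vcat nc (map D (x # xs)) \<in> carrier_mat (e x + ?n) nc"
    using vcat_carrier[of "x # xs" D e nc] Cons.prems by auto
  have Dx: "D x \<in> carrier_mat (e x) nc" using Cons.prems by simp
  have len: "length (concat (map rows (map D xs))) = ?n"
    using H unfolding vcat_def by (metis carrier_matD(1) mat_of_rows_carrier(2))
  have "vcat nc (map D (x # xs)) *\<^sub>v z = (D x *\<^sub>v z) @\<^sub>v (?H *\<^sub>v z)"
  proof (rule eq_vecI)
    fix j assume "j < dim_vec ((D x *\<^sub>v z) @\<^sub>v (?H *\<^sub>v z))"
    then have j: "j < e x + ?n" using Dx H by simp
    have "row (vcat nc (map D (x # xs))) j = (if j < e x then row (D x) j else row ?H (j - e x))"
    proof (rule eq_vecI)
      show "row (vcat nc (map D (x # xs))) j $ i = (if j < e x then row (D x) j else row ?H (j - e x)) $ i"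
        if "i < dim_vec (if j < e x then row (D x) j else row ?H (j - e x))" for i
        using j Dx H H' len that
        by (auto simp: vcat_def mat_of_rows_index nth_append split: if_splits)
    qed (use Dx H H' in auto)
    then show "(vcat nc (map D (x # xs)) *\<^sub>v z) $ j = ((D x *\<^sub>v z) @\<^sub>v (?H *\<^sub>v z)) $ j"
      using j Dx H H' by auto
  qed (use Dx H H' in auto)
  then show ?case using Cons by simp
qed

lemma diag_block_mat_carrier:
  assumes "\<And>x. x \<in> set xs \<Longrightarrow> D x \<in> carrier_mat (e x) (d x)"
  shows "diag_block_mat (map D xs) \<in> carrier_mat (sum_list (map e xs)) (sum_list (map d xs))"
proof -
  have "map dim_row (map D xs) = map e xs" "map dim_col (map D xs) = map d xs"
    using assms by auto
  then show ?thesis by (intro carrier_matI) (simp_all only: dim_diag_block_mat)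
qed

lemma diag_block_mat_mult_stack:
  assumes "\<And>x. x \<in> set xs \<Longrightarrow> D x \<in> carrier_mat (e x) (d x)"
    and "\<And>x. x \<in> set xs \<Longrightarrow> f x \<in> carrier_vec (d x)"
  shows "diag_block_mat (map D xs) *\<^sub>v stack (map f xs) = stack (map (\<lambda>x. D x *\<^sub>v f x) xs)"
  using assms
proof (induction xs)
  case (Cons x xs)
  let ?B = "diag_block_mat (map D xs)"
  have B: "?B \<in> carrier_mat (sum_list (map e xs)) (sum_list (map d xs))"
    using Cons.prems by (intro diag_block_mat_carrier) auto
  have Dx: "D x \<in> carrier_mat (e x) (d x)" and fx: "f x \<in> carrier_vec (d x)" using Cons.prems by auto
  have s: "stack (map f xs) \<in> carrier_vec (sum_list (map d xs))"
    using Cons.prems by (intro stack_carrier) auto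
  have zero: "0\<^sub>m a b *\<^sub>v v = 0\<^sub>v a" if "v \<in> carrier_vec b" for a b and v :: "real vec"
    using that by (intro eq_vecI) auto
  show ?case
    using Cons.IH Cons.prems mult_mat_vec_carrier[OF Dx fx] mult_mat_vec_carrier[OF B s]
    by (simp add: Let_def carrier_matD[OF Dx] carrier_matD[OF B] zero fx s four_block_mat_mult_vec[OF Dx zero_carrier_mat zero_carrier_mat B fx s])
qed auto

text \<open>Signals of all subsystems over a time interval: the outer list runs over time, the inner list over subsystems.\<close>

abbreviation stack2 :: "('k \<Rightarrow> 'i \<Rightarrow> real vec) \<Rightarrow> 'k list \<Rightarrow> 'i list \<Rightarrow> real vec" where
  "stack2 g ks xs \<equiv> stack (map (\<lambda>k. stack (map (g k) xs)) ks)"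

lemma stack2_decompose:
  assumes "distinct ks" "distinct xs" and v: "v \<in> carrier_vec (length ks * sum_list (map d xs))"
  obtains g where "\<forall>k\<in>set ks. \<forall>x\<in>set xs. g k x \<in> carrier_vec (d x)" "v = stack2 g ks xs"
proof -
  obtain f where f: "\<forall>k\<in>set ks. f k \<in> carrier_vec (sum_list (map d xs))" "v = stack (map f ks)"
    by (rule stack_decompose[OF assms(1), of v "\<lambda>_. sum_list (map d xs)"]) (use v in \<open>auto simp: sum_list_triv\<close>)
  have "\<exists>g. (\<forall>x\<in>set xs. g x \<in> carrier_vec (d x)) \<and> f k = stack (map g xs)" if "k \<in> set ks" for k
    using stack_decompose[OF assms(2), of "f k" d] f(1) that by metis
  then obtain g where g: "\<And>k. k \<in> set ks \<Longrightarrow> (\<forall>x\<in>set xs. g k x \<in> carrier_vec (d x)) \<and> f k = stack (map (g k) xs)"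
    by metis
  then have "map f ks = map (\<lambda>k. stack (map (g k) xs)) ks" by simp
  with f(2) have "v = stack2 g ks xs" by (simp only:)
  with g show ?thesis by (intro that[of g]) auto
qed

lemma stack2_scalar_prod:
  assumes "distinct ks" "distinct xs"
    and "\<And>k x. k \<in> set ks \<Longrightarrow> x \<in> set xs \<Longrightarrow> f k x \<in> carrier_vec (d x)"
    and "\<And>k x. k \<in> set ks \<Longrightarrow> x \<in> set xs \<Longrightarrow> g k x \<in> carrier_vec (d x)"
  shows "stack2 f ks xs \<bullet> stack2 g ks xs = (\<Sum>(x, k)\<in>set xs \<times> set ks. f k x \<bullet> g k x)"
proof -
  have "stack2 f ks xs \<bullet> stack2 g ks xs = (\<Sum>k\<leftarrow>ks. stack (map (f k) xs) \<bullet> stack (map (g k) xs))"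
    by (rule stack_scalar_prod[where d = "\<lambda>_. sum_list (map d xs)"]) (auto intro!: stack_carrier assms)
  also have "\<dots> = (\<Sum>k\<in>set ks. stack (map (f k) xs) \<bullet> stack (map (g k) xs))"
    by (rule sum_list_distinct_conv_sum_set[OF assms(1)])
  also have "\<dots> = (\<Sum>k\<in>set ks. \<Sum>x\<in>set xs. f k x \<bullet> g k x)"
  proof (rule sum.cong)
    fix k assume "k \<in> set ks"
    then have "stack (map (f k) xs) \<bullet> stack (map (g k) xs) = (\<Sum>x\<leftarrow>xs. f k x \<bullet> g k x)"
      by (intro stack_scalar_prod[where d = d]) (auto intro!: assms)
    then show "stack (map (f k) xs) \<bullet> stack (map (g k) xs) = (\<Sum>x\<in>set xs. f k x \<bullet> g k x)"
      by (simp add: sum_list_distinct_conv_sum_set[OF assms(2)])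
  qed simp
  also have "\<dots> = (\<Sum>(x, k)\<in>set xs \<times> set ks. f k x \<bullet> g k x)"
    by (subst sum.swap) (rule sum.cartesian_product)
  finally show ?thesis .
qed

lemma diag_block_mat_mult_stack2:
  assumes "\<And>x. x \<in> set xs \<Longrightarrow> P x \<in> carrier_mat (d x) (d x)"
    and "\<And>k x. k \<in> set ks \<Longrightarrow> x \<in> set xs \<Longrightarrow> g k x \<in> carrier_vec (d x)"
  shows "diag_block_mat (replicate (length ks) (diag_block_mat (map P xs))) *\<^sub>v stack2 g ks xs =
    stack2 (\<lambda>k x. P x *\<^sub>v g k x) ks xs"
proof -
  let ?n = "sum_list (map d xs)"
  have "diag_block_mat (map (\<lambda>_. diag_block_mat (map P xs)) ks) *\<^sub>v stack2 g ks xs =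
      stack (map (\<lambda>k. diag_block_mat (map P xs) *\<^sub>v stack (map (g k) xs)) ks)"
    by (rule diag_block_mat_mult_stack[where d = "\<lambda>_. ?n" and e = "\<lambda>_. ?n"])
       (auto intro!: diag_block_mat_carrier stack_carrier assms)
  also have "map (\<lambda>k. diag_block_mat (map P xs) *\<^sub>v stack (map (g k) xs)) ks =
      map (\<lambda>k. stack (map (\<lambda>x. P x *\<^sub>v g k x) xs)) ks"
    by (rule map_cong[OF refl], rule diag_block_mat_mult_stack[where d = d and e = d]) (auto intro: assms)
  finally show ?thesis by (simp add: map_replicate_const)
qed

section \<open>Covariance matrices and whitening\<close>

lemma covariance_mat_diag_block:
  assumes "distinct xs" and cov: "\<And>x. x \<in> set xs \<Longrightarrow> covariance_mat (d x) (P x)"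
  shows "covariance_mat (sum_list (map d xs)) (diag_block_mat (map P xs))"
proof -
  let ?n = "sum_list (map d xs)" and ?D = "diag_block_mat (map P xs)"
  have P: "P x \<in> carrier_mat (d x) (d x)" if "x \<in> set xs" for x
    using cov[OF that] by (simp add: covariance_mat_def)
  have D: "?D \<in> carrier_mat ?n ?n" using P by (rule diag_block_mat_carrier)
  have "transpose_mat ?D = ?D"
    using cov
  proof (induction xs)
    case (Cons x xs)
    have P: "P y \<in> carrier_mat (d y) (d y)" "transpose_mat (P y) = P y" if "y \<in> set (x # xs)" for y
      using Cons.prems[OF that] by (simp_all add: covariance_mat_def)
    have B: "diag_block_mat (map P xs) \<in> carrier_mat (sum_list (map d xs)) (sum_list (map d xs))"
      using P(1) by (intro diag_block_mat_carrier) auto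
    have Px: "P x \<in> carrier_mat (d x) (d x)" using P by simp
    show ?case
      using Cons B P Px
      by (simp add: Let_def carrier_matD[OF Px] carrier_matD[OF B]
          transpose_four_block_mat[OF Px zero_carrier_mat zero_carrier_mat B])
  qed auto
  moreover have "0 \<le> a \<bullet> (?D *\<^sub>v a)" if a: "a \<in> carrier_vec ?n" for a
  proof -
    obtain f where f: "\<forall>x\<in>set xs. f x \<in> carrier_vec (d x)" "a = stack (map f xs)"
      by (rule stack_decompose[OF assms(1) a]) blast
    have f': "\<And>x. x \<in> set xs \<Longrightarrow> f x \<in> carrier_vec (d x)" using f(1) by blast
    have "?D *\<^sub>v a = stack (map (\<lambda>x. P x *\<^sub>v f x) xs)"
      unfolding f(2) by (rule diag_block_mat_mult_stack[where d = d and e = d]) (use P f' in auto)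
    then have "a \<bullet> (?D *\<^sub>v a) = (\<Sum>x\<leftarrow>xs. f x \<bullet> (P x *\<^sub>v f x))"
      unfolding f(2) by (simp only:) (rule stack_scalar_prod[where d = d], use f' mult_mat_vec_carrier[OF P f'] in auto)
    also have "\<dots> \<ge> 0"
      using cov f' by (intro sum_list_nonneg) (auto simp: covariance_mat_def)
    finally show ?thesis .
  qed
  ultimately show ?thesis using D by (simp add: covariance_mat_def)
qed

lemma covariance_mat_replicate:
  assumes "covariance_mat d P"
  shows "covariance_mat (T * d) (diag_block_mat (replicate T P))"
  using covariance_mat_diag_block[of "[0..<T]" "\<lambda>_. d" "\<lambda>_. P"] assms
  by (simp add: map_replicate_const sum_list_replicate)

lemma covariance_mat_add:
  assumes "covariance_mat d P" "covariance_mat d R"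
  shows "covariance_mat d (P + R)"
  using assms unfolding covariance_mat_def
  by (auto simp: transpose_add add_mult_distrib_mat_vec[of _ d d] scalar_prod_add_distrib[of _ d])

lemma quad_form_congruence:
  fixes P F :: "real mat"
  assumes P: "P \<in> carrier_mat d d" and F: "F \<in> carrier_mat n d"
    and a: "a \<in> carrier_vec n"
  shows "a \<bullet> (F * P * transpose_mat F *\<^sub>v a) = (transpose_mat F *\<^sub>v a) \<bullet> (P *\<^sub>v (transpose_mat F *\<^sub>v a))"
proof -
  have "F * P * transpose_mat F *\<^sub>v a = F *\<^sub>v (P *\<^sub>v (transpose_mat F *\<^sub>v a))"
    using assms by (simp add: assoc_mult_mat_vec[of _ n d _ n] assoc_mult_mat_vec[of _ n d _ d])
  then show ?thesis
    using transpose_vec_mult_scalar[OF F _ a, of "P *\<^sub>v (transpose_mat F *\<^sub>v a)"] assms by simp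
qed

lemma covariance_mat_congruence:
  assumes P: "covariance_mat d P" and F: "F \<in> carrier_mat n d"
  shows "covariance_mat n (F * P * transpose_mat F)"
proof -
  have P': "P \<in> carrier_mat d d" "transpose_mat P = P" using P by (auto simp: covariance_mat_def)
  have "transpose_mat (F * P * transpose_mat F) = F * P * transpose_mat F"
    using P' F by (simp add: transpose_mult[of _ n d _ n] transpose_mult[of _ n d _ d]
        transpose_mult[of _ d d _ n] assoc_mult_mat[of _ n d _ d _ n])
  moreover have "0 \<le> a \<bullet> (F * P * transpose_mat F *\<^sub>v a)" if a: "a \<in> carrier_vec n" for a
    using P F a unfolding quad_form_congruence[OF P'(1) F a] by (auto simp: covariance_mat_def)
  ultimately show ?thesis using P' F by (simp add: covariance_mat_def)
qed

lemma covariance_mat_filtered_cov: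
  assumes "K \<in> carrier_mat r (T * p)" "F \<in> carrier_mat (T * p) (T * n)"
    and "covariance_mat n P" "covariance_mat p R"
  shows "covariance_mat r (filtered_cov T K F P R)"
  unfolding filtered_cov_def
  by (rule covariance_mat_congruence[OF covariance_mat_add[OF covariance_mat_congruence]])
     (rule covariance_mat_replicate assms)+

text \<open>The variance of the functional \<open>a\<close> of the filtered noise, expressed by its weights \<open>c\<close> on the process noise
  and \<open>b\<close> on the measurement noise.\<close>

lemma filtered_cov_quad_form:
  assumes K: "K \<in> carrier_mat r (T * p)" and F: "F \<in> carrier_mat (T * p) (T * n)"
    and P: "covariance_mat n P" and R: "covariance_mat p R" and a: "a \<in> carrier_vec r"
    and b: "b = transpose_mat K *\<^sub>v a" and c: "c = transpose_mat F *\<^sub>v b"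
  shows "a \<bullet> (filtered_cov T K F P R *\<^sub>v a) =
    c \<bullet> (diag_block_mat (replicate T P) *\<^sub>v c) + b \<bullet> (diag_block_mat (replicate T R) *\<^sub>v b)"
proof -
  have DP: "diag_block_mat (replicate T P) \<in> carrier_mat (T * n) (T * n)"
    and DR: "diag_block_mat (replicate T R) \<in> carrier_mat (T * p) (T * p)"
    using covariance_mat_replicate[OF P] covariance_mat_replicate[OF R] by (simp_all add: covariance_mat_def)
  have bc: "b \<in> carrier_vec (T * p)" using K a b by simp
  have FPF: "F * diag_block_mat (replicate T P) * transpose_mat F \<in> carrier_mat (T * p) (T * p)"
    using F DP by auto
  have "a \<bullet> (filtered_cov T K F P R *\<^sub>v a) =
      b \<bullet> ((F * diag_block_mat (replicate T P) * transpose_mat F + diag_block_mat (replicate T R)) *\<^sub>v b)"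
    unfolding filtered_cov_def b by (rule quad_form_congruence[OF _ K a]) (use FPF DR in simp)
  also have "\<dots> = b \<bullet> (F * diag_block_mat (replicate T P) * transpose_mat F *\<^sub>v b) + b \<bullet> (diag_block_mat (replicate T R) *\<^sub>v b)"
    unfolding add_mult_distrib_mat_vec[OF FPF DR bc]
    by (rule scalar_prod_add_distrib[OF bc]) (use FPF DR bc in \<open>auto intro: mult_mat_vec_carrier\<close>)
  finally show ?thesis unfolding quad_form_congruence[OF DP F bc] c .
qed

lemma scalar_prod_self:
  fixes b :: "real vec"
  shows "b \<bullet> b = (\<Sum>j<dim_vec b. (b $ j)\<^sup>2)"
  by (simp add: scalar_prod_def power2_eq_square lessThan_atLeast0)

text \<open>A nonnegative quadratic form that vanishes at \<open>a\<close> has a minimum there, so its gradient \<open>2 S a\<close>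
  vanishes, which invertibility excludes for \<open>a \<noteq> 0\<close>.\<close>

lemma pos_def_of_invertible:
  assumes cov: "covariance_mat n S" and inv: "invertible_mat S"
    and a: "a \<in> carrier_vec n" "a \<noteq> 0\<^sub>v n"
  shows "0 < a \<bullet> (S *\<^sub>v a)"
proof (rule ccontr)
  have S: "S \<in> carrier_mat n n" "transpose_mat S = S"
    and psd: "\<And>a. a \<in> carrier_vec n \<Longrightarrow> 0 \<le> a \<bullet> (S *\<^sub>v a)"
    using cov by (auto simp: covariance_mat_def)
  assume "\<not> 0 < a \<bullet> (S *\<^sub>v a)"
  with psd[OF a(1)] have 0: "a \<bullet> (S *\<^sub>v a) = 0" by simp
  define b where "b = S *\<^sub>v a"
  have b: "b \<in> carrier_vec n" using S a by (simp add: b_def)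
  have ab: "a \<bullet> (S *\<^sub>v b) = b \<bullet> b"
    using transpose_vec_mult_scalar[OF S(1) b a(1)] S(2) by (simp add: b_def)
  have Sb: "S *\<^sub>v b \<in> carrier_vec n" using S b by simp
  \<comment> \<open>The form is nonnegative along the line through \<open>a\<close> with direction \<open>- S a\<close>, and its slope at \<open>a\<close> is \<open>- 2 |S a|^2\<close>.\<close>
  have line: "0 \<le> - (2 * s * (b \<bullet> b)) + s\<^sup>2 * (b \<bullet> (S *\<^sub>v b))" for s :: real
  proof -
    have "0 \<le> (a + (- s) \<cdot>\<^sub>v b) \<bullet> (S *\<^sub>v (a + (- s) \<cdot>\<^sub>v b))"
      using a b by (intro psd) simp
    also have "S *\<^sub>v (a + (- s) \<cdot>\<^sub>v b) = b + (- s) \<cdot>\<^sub>v (S *\<^sub>v b)"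
      using S a b by (simp add: mult_add_distrib_mat_vec[of _ n n] mult_mat_vec[of _ n n] b_def)
    also have "(a + (- s) \<cdot>\<^sub>v b) \<bullet> (b + (- s) \<cdot>\<^sub>v (S *\<^sub>v b)) =
        a \<bullet> b + (- s) * (a \<bullet> (S *\<^sub>v b)) + ((- s) * (b \<bullet> b) + (- s) * ((- s) * (b \<bullet> (S *\<^sub>v b))))"
      using a b Sb
      by (simp add: add_scalar_prod_distrib[of _ n] scalar_prod_add_distrib[of _ n] algebra_simps)
    also have "\<dots> = - (2 * s * (b \<bullet> b)) + s\<^sup>2 * (b \<bullet> (S *\<^sub>v b))"
      using 0 ab by (simp add: b_def[symmetric] power2_eq_square)
    finally show ?thesis .
  qed
  have "b \<bullet> b = 0"
  proof (rule ccontr)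
    assume "b \<bullet> b \<noteq> 0"
    then have pos: "b \<bullet> b > 0"
      using sum_nonneg[of "{..<dim_vec b}" "\<lambda>j. (b $ j)\<^sup>2"] by (simp add: scalar_prod_self)
    define q where "q = b \<bullet> (S *\<^sub>v b)"
    have q: "q \<ge> 0" unfolding q_def by (rule psd[OF b])
    define s where "s = (b \<bullet> b) / (q + 1)"
    have s: "s > 0" using pos q by (simp add: s_def)
    have "s * q < b \<bullet> b" using pos q by (simp add: s_def field_simps)
    then have "s * (s * q) < s * (2 * (b \<bullet> b))" using s pos by (intro mult_strict_left_mono) auto
    then show False using line[of s] by (simp add: q_def power2_eq_square mult_ac)
  qed
  then have "b = 0\<^sub>v n" using b
    by (intro eq_vecI) (auto simp: scalar_prod_self sum_nonneg_eq_0_iff)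
  moreover obtain B where B: "B * S = 1\<^sub>m n" "B \<in> carrier_mat n n"
  proof -
    obtain B where "inverts_mat S B" "inverts_mat B S" using inv by (auto simp: invertible_mat_def)
    then have *: "S * B = 1\<^sub>m n" "B * S = 1\<^sub>m (dim_row B)" using S by (auto simp: inverts_mat_def)
    have "dim_row B = n" using arg_cong[OF *(2), of dim_col] S by simp
    moreover have "dim_col B = n" using arg_cong[OF *(1), of dim_col] S by simp
    ultimately show ?thesis using that[of B] * by auto
  qed
  then have "B *\<^sub>v b = a" unfolding b_def using S a by (simp add: assoc_mult_mat_vec[symmetric, of _ n n _ n])
  ultimately show False using a B(2) by auto
qed

text \<open>Gram-Schmidt for the inner product defined by \<open>S\<close>: its orthonormal vectors are the rows of \<open>W\<close>,
  and a Gaussian vector with covariance \<open>S\<close> is mapped by \<open>W\<close> to one with covariance \<open>1\<close>.\<close>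

lemma whitening:
  assumes cov: "covariance_mat n S" and inv: "invertible_mat S"
  obtains W where "W \<in> carrier_mat n n" "W * S * transpose_mat W = 1\<^sub>m n"
proof -
  have S: "S \<in> carrier_mat n n" "transpose_mat S = S"
    using cov by (auto simp: covariance_mat_def)
  have swap: "a \<bullet> (S *\<^sub>v b) = b \<bullet> (S *\<^sub>v a)" if "a \<in> carrier_vec n" "b \<in> carrier_vec n" for a b
    using transpose_vec_mult_scalar[OF S(1) that(2,1)] S that
    by (simp add: comm_scalar_prod[of "S *\<^sub>v a" n b])
  have "\<exists>m. (\<forall>i<k. m i \<in> carrier_vec n) \<and>
      (\<forall>i<k. \<forall>j<k. m i \<bullet> (S *\<^sub>v m j) = (if i = j then 1 else 0))" if "k \<le> n" for k
    using that
  proof (induction k)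
    case 0
    then show ?case by simp
  next
    case (Suc k)
    then obtain m where m: "\<And>i. i < k \<Longrightarrow> m i \<in> carrier_vec n"
      and orth: "\<And>i j. i < k \<Longrightarrow> j < k \<Longrightarrow> m i \<bullet> (S *\<^sub>v m j) = (if i = j then 1 else 0)"
      by auto
    \<comment> \<open>Fewer than \<open>n\<close> linear conditions have a nonzero common solution.\<close>
    define R where "R = mat\<^sub>r n n (\<lambda>i. if i = k then 0\<^sub>v n else if i < k then S *\<^sub>v m i else 0\<^sub>v n)"
    have R: "R \<in> carrier_mat n n" by (simp add: R_def)
    have "det R = 0"
      unfolding R_def by (rule det_row_0) (use Suc.prems S m in auto)
    then obtain v where v: "v \<in> carrier_vec n" "v \<noteq> 0\<^sub>v n" "R *\<^sub>v v = 0\<^sub>v n"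
      using det_0_iff_vec_prod_zero_field[OF R] by auto
    have mv: "m i \<bullet> (S *\<^sub>v v) = 0" if i: "i < k" for i
    proof -
      have "row R i = S *\<^sub>v m i"
        unfolding R_def using i Suc.prems S m by (subst row_mat_of_row_fun) auto
      then have "(S *\<^sub>v m i) \<bullet> v = (R *\<^sub>v v) $ i" using R i Suc.prems by simp
      then have "(S *\<^sub>v m i) \<bullet> v = 0" using v(3) i Suc.prems by simp
      then show ?thesis
        using swap[OF m[OF i] v(1)] S m[OF i] v(1) by (simp add: comm_scalar_prod[of _ n v])
    qed
    define q where "q = v \<bullet> (S *\<^sub>v v)"
    have q: "q > 0" unfolding q_def by (rule pos_def_of_invertible[OF cov inv v(1,2)])
    define u where "u = (1 / sqrt q) \<cdot>\<^sub>v v"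
    have u: "u \<in> carrier_vec n" using v by (simp add: u_def)
    have Su: "S *\<^sub>v u = (1 / sqrt q) \<cdot>\<^sub>v (S *\<^sub>v v)" unfolding u_def by (rule mult_mat_vec[OF S(1) v(1)])
    have uu: "u \<bullet> (S *\<^sub>v u) = 1"
    proof -
      have "u \<bullet> (S *\<^sub>v u) = (1 / sqrt q) * ((1 / sqrt q) * q)"
        unfolding Su using S v by (simp add: u_def q_def)
      also have "\<dots> = q / (sqrt q * sqrt q)" by simp
      also have "\<dots> = 1" using q by simp
      finally show ?thesis .
    qed
    have mu: "m i \<bullet> (S *\<^sub>v u) = 0" if "i < k" for i
      using mv[OF that] m[OF that] S v unfolding Su by simp
    show ?case
      using m orth u uu mu swap[OF u m]
      by (intro exI[of _ "m(k := u)"]) (auto simp: less_Suc_eq)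
  qed
  from this[OF order_refl] obtain m where m: "\<And>i. i < n \<Longrightarrow> m i \<in> carrier_vec n"
    and orth: "\<And>i j. i < n \<Longrightarrow> j < n \<Longrightarrow> m i \<bullet> (S *\<^sub>v m j) = (if i = j then 1 else 0)"
    by auto
  define W where "W = mat\<^sub>r n n m"
  have W: "W \<in> carrier_mat n n" by (simp add: W_def)
  have row: "row W i = m i" if "i < n" for i
    unfolding W_def using that m by (subst row_mat_of_row_fun) auto
  have "W * S * transpose_mat W = W * (S * transpose_mat W)"
    using W S by (simp add: assoc_mult_mat[of _ n n _ n _ n])
  also have "\<dots> = 1\<^sub>m n"
  proof (rule eq_matI)
    fix i j assume "i < dim_row (1\<^sub>m n :: real mat)" "j < dim_col (1\<^sub>m n :: real mat)"
    then have ij: "i < n" "j < n" by auto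
    have "col (S * transpose_mat W) j = S *\<^sub>v m j"
      using W S ij row[OF ij(2)] by (subst col_mult2[of _ n n _ n]) auto
    then show "(W * (S * transpose_mat W)) $$ (i, j) = (1\<^sub>m n :: real mat) $$ (i, j)"
      using W S ij row[OF ij(1)] orth[OF ij] by simp
  qed (use W S in auto)
  finally show ?thesis using that W by blast
qed

text \<open>\<open>W S W\<^sup>T = 1\<close> gives \<open>S\<^bsup>-1\<^esup> = W\<^sup>T W\<close>, so the test statistic is the squared length of the whitened vector.\<close>

lemma inv_quad_form_whitened:
  assumes S: "S \<in> carrier_mat n n" and W: "W \<in> carrier_mat n n" "W * S * transpose_mat W = 1\<^sub>m n"
    and z: "z \<in> carrier_vec n"
  shows "inv_quad_form S z = (\<Sum>j<n. ((W *\<^sub>v z) $ j)\<^sup>2)"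
proof -
  let ?V = "transpose_mat W * W"
  have Wt: "transpose_mat W \<in> carrier_mat n n" using W by simp
  have V: "?V \<in> carrier_mat n n" using W by simp
  have "W * (S * transpose_mat W) = 1\<^sub>m n"
    using W S by (simp add: assoc_mult_mat[of _ n n _ n _ n])
  then have "(S * transpose_mat W) * W = 1\<^sub>m n"
    by (rule mat_mult_left_right_inverse[OF W(1), rotated]) (use S W in simp)
  then have SV: "S * ?V = 1\<^sub>m n" using W S by (simp add: assoc_mult_mat[of _ n n _ n _ n])
  then have VS: "?V * S = 1\<^sub>m n" by (rule mat_mult_left_right_inverse[OF S V])
  have "S \<in> Units (ring_mat TYPE(real) n ())"
    using S V SV VS unfolding Units_def ring_mat_def by auto
  then obtain B where "mat_inverse S = Some B"
    using mat_inverse(1)[OF S, of "()"] by (cases "mat_inverse S") auto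
  moreover from mat_inverse(2)[OF S this] have B: "B * S = 1\<^sub>m n" "B \<in> carrier_mat n n" by auto
  have "B = B * (S * ?V)" using SV B by simp
  also have "\<dots> = ?V" unfolding assoc_mult_mat[OF B(2) S V, symmetric] B(1) by (rule left_mult_one_mat[OF V])
  finally have "inv_quad_form S z = z \<bullet> (?V *\<^sub>v z)"
    using \<open>mat_inverse S = Some B\<close> by (simp add: inv_quad_form_def)
  also have "\<dots> = z \<bullet> (transpose_mat W *\<^sub>v (W *\<^sub>v z))"
    using W z by (simp add: assoc_mult_mat_vec[of _ n n _ n])
  also have "\<dots> = (W *\<^sub>v z) \<bullet> (W *\<^sub>v z)"
    using transpose_vec_mult_scalar[OF Wt, of "W *\<^sub>v z" z] W z by simp
  also have "\<dots> = (\<Sum>j<n. ((W *\<^sub>v z) $ j)\<^sup>2)"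
    using W by (simp add: scalar_prod_def power2_eq_square lessThan_atLeast0)
  finally show ?thesis .
qed

section \<open>The lower tail of the noncentral chi-squared law\<close>

text \<open>The damping factor turns the standard normal density into one of variance \<open>1 / (1 + 2 t)\<close>, up to a factor,
  so that a linear substitution leads back to the characteristic function of the standard normal law.\<close>

lemma std_normal_damped_cf:
  fixes t c :: real
  assumes "0 \<le> t"
  shows "(CLINT g|std_normal_distribution. iexp (c * g) * exp (- (t * g\<^sup>2))) =
    1 / sqrt (1 + 2 * t) * exp (- (c\<^sup>2 / (2 * (1 + 2 * t))))"
proof -
  define a where "a = sqrt (1 + 2 * t)"
  have a: "a > 0" "a\<^sup>2 = 1 + 2 * t" using assms by (auto simp: a_def)
  have dens: "std_normal_density g * exp (- (t * g\<^sup>2)) = std_normal_density (a * g)" for g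
  proof -
    have "exp (- (g\<^sup>2 / 2)) * exp (- (t * g\<^sup>2)) = exp (- ((a * g)\<^sup>2 / 2))"
      unfolding exp_add[symmetric] power_mult_distrib a(2) by (simp add: field_simps)
    then show ?thesis by (simp add: std_normal_density_def)
  qed
  have "complex_of_real (exp (- ((c / a)\<^sup>2 / 2))) = char std_normal_distribution (c / a)"
    by (simp add: char_std_normal_distribution)
  also have "\<dots> = (CLBINT g. std_normal_density g *\<^sub>R iexp (c / a * g))"
    unfolding char_def by (subst integral_density) auto
  also have "\<dots> = \<bar>a\<bar> *\<^sub>R (CLBINT g. std_normal_density (0 + a * g) *\<^sub>R iexp (c / a * (0 + a * g)))"
    by (rule lborel_integral_real_affine) (use a in auto)
  also have "(\<lambda>g. std_normal_density (0 + a * g) *\<^sub>R iexp (c / a * (0 + a * g))) =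
      (\<lambda>g. std_normal_density g *\<^sub>R (iexp (c * g) * exp (- (t * g\<^sup>2))))"
  proof
    fix g
    have "std_normal_density (0 + a * g) *\<^sub>R iexp (c / a * (0 + a * g)) = std_normal_density (a * g) *\<^sub>R iexp (c * g)"
      using a(1) by simp
    also have "\<dots> = std_normal_density g *\<^sub>R (iexp (c * g) * exp (- (t * g\<^sup>2)))"
      unfolding dens[symmetric] by (simp add: scaleR_conv_of_real)
    finally show "std_normal_density (0 + a * g) *\<^sub>R iexp (c / a * (0 + a * g)) =
      std_normal_density g *\<^sub>R (iexp (c * g) * exp (- (t * g\<^sup>2)))" .
  qed
  also have "(CLBINT g. \<dots> g) = (CLINT g|std_normal_distribution. iexp (c * g) * exp (- (t * g\<^sup>2)))"
    by (subst integral_density) auto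
  finally have "complex_of_real (exp (- ((c / a)\<^sup>2 / 2))) =
      of_real a * (CLINT g|std_normal_distribution. iexp (c * g) * exp (- (t * g\<^sup>2)))"
    using a(1) by (simp add: scaleR_conv_of_real)
  moreover have "(c / a)\<^sup>2 / 2 = c\<^sup>2 / (2 * (1 + 2 * t))"
    by (simp add: power_divide a(2))
  ultimately have eq: "complex_of_real (exp (- (c\<^sup>2 / (2 * (1 + 2 * t))))) =
      of_real a * (CLINT g|std_normal_distribution. iexp (c * g) * exp (- (t * g\<^sup>2)))" by simp
  have "I = of_real (1 / a * E)" if "of_real E = complex_of_real a * I" for I E
    using a(1) that by simp
  from this[OF eq] show ?thesis by (simp only: a_def)
qed

lemma std_normal_product_cf:
  fixes c :: "nat \<Rightarrow> real" and t :: real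
  assumes "0 \<le> t"
  shows "(CLINT g|PiM {..<n} (\<lambda>_. std_normal_distribution).
      iexp (\<Sum>j<n. c j * g j) * exp (- (t * (\<Sum>j<n. (g j)\<^sup>2)))) =
    (1 / sqrt (1 + 2 * t)) ^ n * exp (- ((\<Sum>j<n. (c j)\<^sup>2) / (2 * (1 + 2 * t))))"
proof -
  interpret N: prob_space std_normal_distribution by (rule prob_space_normal_density) simp
  interpret product_sigma_finite "\<lambda>_::nat. std_normal_distribution"
    by (rule product_sigma_finite.intro) (rule N.sigma_finite_measure_axioms)
  have split: "iexp (\<Sum>j<n. c j * g j) * exp (- (t * (\<Sum>j<n. (g j)\<^sup>2))) =
      (\<Prod>j<n. iexp (c j * g j) * exp (- (t * (g j)\<^sup>2)))" for g :: "nat \<Rightarrow> real"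
  proof -
    have "iexp (\<Sum>j<n. c j * g j) = (\<Prod>j<n. iexp (c j * g j))"
      by (simp add: sum_distrib_left exp_sum)
    moreover have "exp (- (t * (\<Sum>j<n. (g j)\<^sup>2))) = (\<Prod>j<n. exp (- (t * (g j)\<^sup>2)))"
      unfolding sum_distrib_left sum_negf[symmetric] by (rule exp_sum) simp
    ultimately show ?thesis by (simp only: prod.distrib of_real_prod)
  qed
  have "integrable std_normal_distribution (\<lambda>g. iexp (c j * g) * complex_of_real (exp (- (t * g\<^sup>2))))" for j
    by (rule N.integrable_const_bound[of _ 1])
       (use assms in \<open>auto simp: norm_mult simp del: of_real_exp\<close>)
  then have "(CLINT g|PiM {..<n} (\<lambda>_. std_normal_distribution).
      (\<Prod>j<n. iexp (c j * g j) * complex_of_real (exp (- (t * (g j)\<^sup>2))))) =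
      (\<Prod>j<n. CLINT g|std_normal_distribution. iexp (c j * g) * exp (- (t * g\<^sup>2)))"
    by (intro product_integral_prod) auto
  also have "\<dots> = (\<Prod>j<n. complex_of_real (1 / sqrt (1 + 2 * t) * exp (- ((c j)\<^sup>2 / (2 * (1 + 2 * t))))))"
    using std_normal_damped_cf[OF assms] by simp
  also have "\<dots> = complex_of_real ((1 / sqrt (1 + 2 * t)) ^ n * exp (- ((\<Sum>j<n. (c j)\<^sup>2) / (2 * (1 + 2 * t)))))"
  proof -
    have "exp (- ((\<Sum>j<n. (c j)\<^sup>2) / (2 * (1 + 2 * t)))) = (\<Prod>j<n. exp (- ((c j)\<^sup>2 / (2 * (1 + 2 * t)))))"
      unfolding sum_divide_distrib sum_negf[symmetric] by (rule exp_sum) simp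
    then show ?thesis by (simp only: of_real_prod[symmetric] prod.distrib prod_constant card_lessThan)
  qed
  finally show ?thesis unfolding split by simp
qed

text \<open>The expectation of \<open>exp (i \<surd>(2 t) (g \<bullet> y))\<close> over a standard Gaussian vector \<open>g\<close> is \<open>exp (- t |y|\<^sup>2)\<close>.
  Averaging over \<open>y = X \<omega>\<close> and exchanging the two integrals replaces the Laplace transform of \<open>|X|\<^sup>2\<close> by
  a Gaussian integral of the characteristic function of \<open>X\<close>. In this way neither a joint density of \<open>X\<close>
  nor independence of its components has to be derived from the characteristic function.\<close>

lemma (in prob_space) laplace_sum_squares:
  fixes X :: "nat \<Rightarrow> 'a \<Rightarrow> real" and \<mu> :: "nat \<Rightarrow> real"
  assumes meas: "\<And>j. j < n \<Longrightarrow> X j \<in> borel_measurable M"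
    and cf: "\<And>a. (CLINT \<omega>|M. iexp (\<Sum>j<n. a j * X j \<omega>)) =
      iexp (\<Sum>j<n. a j * \<mu> j) * complex_of_real (exp (- ((\<Sum>j<n. (a j)\<^sup>2) / 2)))"
    and t: "0 \<le> t"
  shows "(LINT \<omega>|M. exp (- (t * (\<Sum>j<n. (X j \<omega>)\<^sup>2)))) =
    (1 / sqrt (1 + 2 * t)) ^ n * exp (- (t * (\<Sum>j<n. (\<mu> j)\<^sup>2) / (1 + 2 * t)))"
proof -
  define G where "G = PiM {..<n} (\<lambda>_. std_normal_distribution)"
  define s where "s = sqrt (2 * t)"
  have s2: "s\<^sup>2 = 2 * t" using t by (simp add: s_def)
  interpret G: prob_space G
    unfolding G_def by (intro prob_space_PiM prob_space_normal_density) simp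
  interpret pair_prob_space M G ..
  have gj: "(\<lambda>g. g j) \<in> borel_measurable G" if "j < n" for j
    using measurable_component_singleton[of j "{..<n}" "\<lambda>_. std_normal_distribution"] that
    by (simp add: G_def)
  have meas2: "(\<lambda>(\<omega>, g). iexp (\<Sum>j<n. s * g j * X j \<omega>)) \<in> borel_measurable (M \<Otimes>\<^sub>M G)"
  proof -
    have "(\<lambda>z. \<Sum>j<n. s * snd z j * X j (fst z)) \<in> borel_measurable (M \<Otimes>\<^sub>M G)"
    proof (intro borel_measurable_sum borel_measurable_times borel_measurable_const)
      fix j assume "j \<in> {..<n}"
      then have j: "j < n" by simp
      show "(\<lambda>z. snd z j) \<in> borel_measurable (M \<Otimes>\<^sub>M G)"
        using measurable_compose[OF measurable_snd gj[OF j]] .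
      show "(\<lambda>z. X j (fst z)) \<in> borel_measurable (M \<Otimes>\<^sub>M G)"
        using measurable_compose[OF measurable_fst meas[OF j]] .
    qed
    then show ?thesis unfolding case_prod_beta' by measurable
  qed
  have int: "integrable (M \<Otimes>\<^sub>M G) (\<lambda>(\<omega>, g). iexp (\<Sum>j<n. s * g j * X j \<omega>))"
    by (rule P.integrable_const_bound[of _ 1]) (use meas2 in auto)
  have inner1: "(CLINT g|G. iexp (\<Sum>j<n. s * g j * X j \<omega>)) = exp (- (t * (\<Sum>j<n. (X j \<omega>)\<^sup>2)))" for \<omega>
  proof -
    have "(\<Sum>j<n. (s * X j \<omega>)\<^sup>2) / 2 = t * (\<Sum>j<n. (X j \<omega>)\<^sup>2)"
      by (simp add: power_mult_distrib s2 sum_distrib_left sum_divide_distrib)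
    then show ?thesis
      using std_normal_product_cf[of 0 n "\<lambda>j. s * X j \<omega>"] by (simp add: G_def mult_ac)
  qed
  have inner2: "(CLINT \<omega>|M. iexp (\<Sum>j<n. s * g j * X j \<omega>)) =
      iexp (\<Sum>j<n. (s * \<mu> j) * g j) * exp (- (t * (\<Sum>j<n. (g j)\<^sup>2)))" for g
  proof -
    have "(\<Sum>j<n. (s * g j)\<^sup>2) / 2 = t * (\<Sum>j<n. (g j)\<^sup>2)"
      by (simp add: power_mult_distrib s2 sum_distrib_left sum_divide_distrib)
    then show ?thesis using cf[of "\<lambda>j. s * g j"] by (simp add: mult_ac)
  qed
  have "(CLINT \<omega>|M. complex_of_real (exp (- (t * (\<Sum>j<n. (X j \<omega>)\<^sup>2))))) =
      (CLINT \<omega>|M. CLINT g|G. iexp (\<Sum>j<n. s * g j * X j \<omega>))"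
    by (simp only: inner1)
  also have "\<dots> = (CLINT g|G. CLINT \<omega>|M. iexp (\<Sum>j<n. s * g j * X j \<omega>))"
    using Fubini_integral[OF int] by simp
  also have "\<dots> = (1 / sqrt (1 + 2 * t)) ^ n * exp (- ((\<Sum>j<n. (s * \<mu> j)\<^sup>2) / (2 * (1 + 2 * t))))"
    unfolding inner2 using std_normal_product_cf[OF t, of n "\<lambda>j. s * \<mu> j"] by (simp add: G_def)
  also have "(\<Sum>j<n. (s * \<mu> j)\<^sup>2) / (2 * (1 + 2 * t)) = t * (\<Sum>j<n. (\<mu> j)\<^sup>2) / (1 + 2 * t)"
  proof -
    have "(\<Sum>j<n. (s * \<mu> j)\<^sup>2) = 2 * (t * (\<Sum>j<n. (\<mu> j)\<^sup>2))"
      by (simp add: power_mult_distrib s2 sum_distrib_left mult_ac)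
    then show ?thesis by (simp only: mult_divide_mult_cancel_left_if) simp
  qed
  finally have "complex_of_real (LINT \<omega>|M. exp (- (t * (\<Sum>j<n. (X j \<omega>)\<^sup>2)))) = 
     complex_of_real ((1 / sqrt (1 + 2 * t)) ^ n * exp (- (t * (\<Sum>j<n. (\<mu> j)\<^sup>2) / (1 + 2 * t))))"
    by (simp add: integral_complex_of_real del: of_real_exp)
  then show ?thesis by (simp only: of_real_eq_iff)
qed

lemma ln_one_plus_lower:
  fixes u :: real
  assumes "0 \<le> u"
  shows "u - u\<^sup>2 / 2 \<le> ln (1 + u)"
proof -
  define f where "f = (\<lambda>u::real. ln (1 + u) - u + u\<^sup>2 / 2)"
  have "f 0 \<le> f u"
  proof (rule DERIV_nonneg_imp_nondecreasing[OF assms])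
    fix x :: real assume x: "0 \<le> x" "x \<le> u"
    have "(f has_real_derivative 1 / (1 + x) - 1 + x) (at x)"
      unfolding f_def by (rule derivative_eq_intros refl | use x in simp)+
    moreover have "1 / (1 + x) - 1 + x = x\<^sup>2 / (1 + x)"
      using x by (simp add: field_simps power2_eq_square)
    ultimately show "\<exists>y. (f has_real_derivative y) (at x) \<and> 0 \<le> y"
      using x by (auto intro!: exI[of _ "x\<^sup>2 / (1 + x)"])
  qed
  then show ?thesis by (simp add: f_def)
qed

text \<open>The left-hand side is the Laplace transform at \<open>t\<close> of the noncentral chi-squared law with \<open>n\<close> degrees
  of freedom and noncentrality \<open>l\<close>. Below its mean \<open>n + l\<close> the law is thus sub-Gaussian, with variance
  proxy \<open>2 (n + 2 l)\<close>, which is its variance.\<close>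

lemma noncentral_chi_square_exponent:
  fixes t l :: real
  assumes t: "0 \<le> t" and l: "0 \<le> l"
  shows "(1 / sqrt (1 + 2 * t)) ^ n * exp (- (t * l / (1 + 2 * t)))
    \<le> exp (- (t * (n + l)) + t\<^sup>2 * (n + 2 * l))"
proof -
  have "1 / sqrt (1 + 2 * t) = exp (- (ln (1 + 2 * t) / 2))"
    using t by (simp add: exp_minus ln_sqrt[symmetric] inverse_eq_divide)
  then have "(1 / sqrt (1 + 2 * t)) ^ n = exp (real n * - (ln (1 + 2 * t) / 2))"
    by (simp only: exp_of_nat_mult)
  moreover have "real n * - (ln (1 + 2 * t) / 2) \<le> real n * (- t + t\<^sup>2)"
    using ln_one_plus_lower[of "2 * t"] t by (intro mult_left_mono) (auto simp: power2_eq_square)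
  moreover have "- (t * l / (1 + 2 * t)) \<le> - (t * l) + 2 * (t\<^sup>2 * l)"
  proof -
    have "t * l / (1 + 2 * t) * (1 + 2 * t) = t * l" using t by simp
    moreover have "(t * l - 2 * (t\<^sup>2 * l)) * (1 + 2 * t) = t * l - 4 * (t\<^sup>2 * t * l)"
      by (simp add: algebra_simps power2_eq_square)
    moreover have "0 \<le> t\<^sup>2 * t * l" using t l by simp
    ultimately have "(t * l - 2 * (t\<^sup>2 * l)) * (1 + 2 * t) \<le> t * l / (1 + 2 * t) * (1 + 2 * t)"
      by linarith
    then have "t * l - 2 * (t\<^sup>2 * l) \<le> t * l / (1 + 2 * t)"
      by (rule mult_right_le_imp_le) (use t in simp)
    then show ?thesis by simp
  qed
  ultimately show ?thesis by (simp add: exp_add[symmetric] algebra_simps)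
qed

text \<open>Birge's bound for the lower tail, by Chernoff's method. The parameter \<open>t = \<surd>(x / (n + 2 l))\<close> minimises
  the exponent \<open>t\<^sup>2 (n + 2 l) - 2 t \<surd>((n + 2 l) x)\<close>, with minimum \<open>- x\<close>.\<close>

lemma (in prob_space) noncentral_chi_square_lower_tail:
  fixes X :: "nat \<Rightarrow> 'a \<Rightarrow> real" and \<mu> :: "nat \<Rightarrow> real"
  assumes meas: "\<And>j. j < n \<Longrightarrow> X j \<in> borel_measurable M"
    and cf: "\<And>a. (CLINT \<omega>|M. iexp (\<Sum>j<n. a j * X j \<omega>)) =
      iexp (\<Sum>j<n. a j * \<mu> j) * complex_of_real (exp (- ((\<Sum>j<n. (a j)\<^sup>2) / 2)))"
    and l: "l = (\<Sum>j<n. (\<mu> j)\<^sup>2)" and x: "0 \<le> x"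
    and \<tau>: "\<tau> \<le> n + l - sqrt (4 * (n + 2 * l) * x)"
  shows "prob {\<omega> \<in> space M. (\<Sum>j<n. (X j \<omega>)\<^sup>2) < \<tau>} \<le> exp (- x)"
proof (cases "n + 2 * l = 0")
  case True
  \<comment> \<open>No optimal \<open>t\<close> exists here, but the condition on \<open>\<tau>\<close> leaves no room for a sum of squares below \<open>\<tau>\<close>.\<close>
  have "l \<ge> 0" unfolding l by (intro sum_nonneg) simp
  with True \<tau> have "\<tau> \<le> 0" by simp
  moreover have "0 \<le> (\<Sum>j<n. (X j \<omega>)\<^sup>2)" for \<omega> by (intro sum_nonneg) simp
  ultimately have empty: "{\<omega> \<in> space M. (\<Sum>j<n. (X j \<omega>)\<^sup>2) < \<tau>} = {}"
    by (auto simp: not_less intro: order_trans)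
  show ?thesis unfolding empty by simp
next
  case False
  have l0: "l \<ge> 0" unfolding l by (intro sum_nonneg) simp
  define K where "K = n + 2 * l"
  have K: "K > 0" using False l0 unfolding K_def by linarith
  define t where "t = sqrt (x / K)"
  have t: "t \<ge> 0" "t\<^sup>2 * K = x" using K x by (auto simp: t_def)
  have root: "sqrt (4 * K * x) = 2 * (t * K)"
  proof -
    have "4 * K * x = (2 * (t * K))\<^sup>2" using t(2) by (simp add: power2_eq_square mult_ac)
    then show ?thesis using t(1) K by (simp only: real_sqrt_abs) simp
  qed
  let ?Q = "\<lambda>\<omega>. \<Sum>j<n. (X j \<omega>)\<^sup>2"
  have Qm: "?Q \<in> borel_measurable M" using meas by measurable
  have int: "integrable M (\<lambda>\<omega>. exp (- (t * ?Q \<omega>)))"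
    by (rule integrable_const_bound[of _ 1])
       (use Qm t(1) in \<open>auto intro!: AE_I2 mult_nonneg_nonneg sum_nonneg\<close>)
  have "prob {\<omega> \<in> space M. ?Q \<omega> < \<tau>} \<le> prob {\<omega> \<in> space M. exp (- (t * ?Q \<omega>)) \<ge> exp (- (t * \<tau>))}"
  proof (rule finite_measure_mono)
    show "{\<omega> \<in> space M. exp (- (t * ?Q \<omega>)) \<ge> exp (- (t * \<tau>))} \<in> events"
      using Qm by measurable
  qed (use t(1) in \<open>auto intro: mult_left_mono\<close>)
  also have "\<dots> \<le> (LINT \<omega>|M. exp (- (t * ?Q \<omega>))) / exp (- (t * \<tau>))"
    by (rule integral_Markov_inequality_measure[OF int sets.empty_sets]) auto
  also have "\<dots> \<le> exp (- (t * (n + l)) + t\<^sup>2 * K) / exp (- (t * \<tau>))"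
  proof -
    have "(LINT \<omega>|M. exp (- (t * ?Q \<omega>))) = (1 / sqrt (1 + 2 * t)) ^ n * exp (- (t * l / (1 + 2 * t)))"
      unfolding l by (rule laplace_sum_squares) (use meas cf t(1) in auto)
    then show ?thesis
      using noncentral_chi_square_exponent[OF t(1) l0, of n] by (simp add: K_def divide_right_mono)
  qed
  also have "\<dots> = exp (t * (\<tau> - (n + l)) + x)"
    using t(2) by (simp add: exp_diff[symmetric] algebra_simps)
  finally have bound: "prob {\<omega> \<in> space M. ?Q \<omega> < \<tau>} \<le> exp (t * (\<tau> - (n + l)) + x)" .
  have "t * (\<tau> - (n + l)) \<le> t * (- (2 * (t * K)))"
    using \<tau> root t(1) by (intro mult_left_mono) (auto simp: K_def)
  also have "t * (- (2 * (t * K))) = - (2 * x)"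
    unfolding t(2)[symmetric] by (simp add: power2_eq_square)
  finally have "exp (t * (\<tau> - (n + l)) + x) \<le> exp (- x)" by simp
  with bound show ?thesis by (rule order_trans)

qed

text \<open>Whitening reduces the test statistic of a Gaussian vector, given by the characteristic functions of
  its linear functionals, to a sum of squares.\<close>

lemma (in prob_space) gaussian_quadratic_form_lower_tail:
  fixes Z :: "'a \<Rightarrow> real vec"
  assumes Z: "\<And>\<omega>. \<omega> \<in> space M \<Longrightarrow> Z \<omega> \<in> carrier_vec n"
    and meas: "\<And>a. a \<in> carrier_vec n \<Longrightarrow> (\<lambda>\<omega>. a \<bullet> Z \<omega>) \<in> borel_measurable M"
    and cf: "\<And>a. a \<in> carrier_vec n \<Longrightarrow>
      (CLINT \<omega>|M. iexp (a \<bullet> Z \<omega>)) = iexp (a \<bullet> \<beta>) * complex_of_real (exp (- ((a \<bullet> (S *\<^sub>v a)) / 2)))"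
    and \<beta>: "\<beta> \<in> carrier_vec n" and cov: "covariance_mat n S" and inv: "invertible_mat S"
    and l: "l = inv_quad_form S \<beta>" and x: "0 \<le> x"
    and \<tau>: "\<tau> \<le> n + l - sqrt (4 * (n + 2 * l) * x)"
  shows "prob {\<omega> \<in> space M. inv_quad_form S (Z \<omega>) < \<tau>} \<le> exp (- x)"
proof -
  obtain W where W: "W \<in> carrier_mat n n" "W * S * transpose_mat W = 1\<^sub>m n"
    using whitening[OF cov inv] .
  have S: "S \<in> carrier_mat n n" using cov by (simp add: covariance_mat_def)
  have lin: "(\<Sum>j<n. a j * (W *\<^sub>v z) $ j) = (transpose_mat W *\<^sub>v vec n a) \<bullet> z"
    if "z \<in> carrier_vec n" for a z
  proof -
    have "(transpose_mat W *\<^sub>v vec n a) \<bullet> z = vec n a \<bullet> (W *\<^sub>v z)"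
      by (rule transpose_vec_mult_scalar[OF W(1) that]) simp
    then show ?thesis using W by (simp add: scalar_prod_def lessThan_atLeast0)
  qed
  have "prob {\<omega> \<in> space M. (\<Sum>j<n. ((W *\<^sub>v Z \<omega>) $ j)\<^sup>2) < \<tau>} \<le> exp (- x)"
  proof (rule noncentral_chi_square_lower_tail[where l = l and \<mu> = "\<lambda>j. (W *\<^sub>v \<beta>) $ j"])
    fix j assume j: "j < n"
    then have "(W *\<^sub>v Z \<omega>) $ j = row W j \<bullet> Z \<omega>" for \<omega> using W by simp
    then show "(\<lambda>\<omega>. (W *\<^sub>v Z \<omega>) $ j) \<in> borel_measurable M"
      using meas[of "row W j"] W j by simp
  next
    fix a :: "nat \<Rightarrow> real"
    let ?b = "transpose_mat W *\<^sub>v vec n a"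
    have b: "?b \<in> carrier_vec n" using W by simp
    have "(CLINT \<omega>|M. iexp (\<Sum>j<n. a j * (W *\<^sub>v Z \<omega>) $ j)) = (CLINT \<omega>|M. iexp (?b \<bullet> Z \<omega>))"
      by (rule Bochner_Integration.integral_cong) (simp_all only: lin[OF Z])
    also have "\<dots> = iexp (?b \<bullet> \<beta>) * complex_of_real (exp (- ((?b \<bullet> (S *\<^sub>v ?b)) / 2)))" by (rule cf[OF b])
    also have "?b \<bullet> (S *\<^sub>v ?b) = vec n a \<bullet> (W * S * transpose_mat W *\<^sub>v vec n a)"
      by (rule quad_form_congruence[symmetric, OF S W(1)]) simp
    also have "\<dots> = (\<Sum>j<n. (a j)\<^sup>2)"
      by (simp add: W(2) scalar_prod_def power2_eq_square lessThan_atLeast0)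
    finally show "(CLINT \<omega>|M. iexp (\<Sum>j<n. a j * (W *\<^sub>v Z \<omega>) $ j)) =
        iexp (\<Sum>j<n. a j * (W *\<^sub>v \<beta>) $ j) * complex_of_real (exp (- ((\<Sum>j<n. (a j)\<^sup>2) / 2)))"
      by (simp only: lin[OF \<beta>])
  qed (use l x \<tau> inv_quad_form_whitened[OF S W \<beta>] in auto)
  also have "{\<omega> \<in> space M. (\<Sum>j<n. ((W *\<^sub>v Z \<omega>) $ j)\<^sup>2) < \<tau>} = {\<omega> \<in> space M. inv_quad_form S (Z \<omega>) < \<tau>}"
    using inv_quad_form_whitened[OF S W Z] by auto
  finally show ?thesis .
qed

section \<open>Sums of independent Gaussian noise\<close>

lemma char_normal_law:
  assumes "0 \<le> s"
  shows "(CLINT x|normal_law 0 s. iexp x) = complex_of_real (exp (- (s / 2)))"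
proof (cases "s = 0")
  case True
  have "(CLINT x|return borel 0. iexp x) = iexp (0::real)"
    by (rule integral_return) auto
  then show ?thesis using True by (simp add: normal_law_def)
next
  case False
  define \<sigma> where "\<sigma> = sqrt s"
  have \<sigma>: "\<sigma> > 0" "\<sigma>\<^sup>2 = s" using False assms by (auto simp: \<sigma>_def)
  have dens: "normal_density 0 \<sigma> (\<sigma> * x) = std_normal_density x / \<sigma>" for x
    using \<sigma>(1) by (simp add: normal_density_def power_mult_distrib real_sqrt_mult)
  have "(CLINT x|normal_law 0 s. iexp x) = (CLBINT x. normal_density 0 \<sigma> x *\<^sub>R iexp x)"
    using False unfolding normal_law_def \<sigma>_def[symmetric] by (simp, subst integral_density) auto
  also have "\<dots> = \<bar>\<sigma>\<bar> *\<^sub>R (CLBINT x. normal_density 0 \<sigma> (0 + \<sigma> * x) *\<^sub>R iexp (0 + \<sigma> * x))"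
    by (rule lborel_integral_real_affine) (use \<sigma> in auto)
  also have "\<dots> = \<bar>\<sigma>\<bar> *\<^sub>R (CLBINT x. (1 / \<sigma>) *\<^sub>R (std_normal_density x *\<^sub>R iexp (\<sigma> * x)))"
    by (simp add: dens)
  also have "\<dots> = (CLBINT x. std_normal_density x *\<^sub>R iexp (\<sigma> * x))"
    unfolding integral_scaleR_right using \<sigma>(1) by simp
  also have "\<dots> = char std_normal_distribution \<sigma>"
    unfolding char_def by (subst integral_density) auto
  finally show ?thesis by (simp add: char_std_normal_distribution \<sigma>(2))
qed

text \<open>The noise vectors are Gaussian in the sense that their linear functionals are, and independent; hence a sum
  of such functionals is a sum of independent normal variables, possibly degenerate.\<close>

lemma (in prob_space) cf_sum_indep_gaussian:
  fixes X :: "'q \<Rightarrow> 'a \<Rightarrow> real vec"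
  assumes ind: "indep_vecs M d X Q" and J: "J \<subseteq> Q"
    and gauss: "\<And>q. q \<in> J \<Longrightarrow> gaussian_vec M (d q) (X q) (0\<^sub>v (d q)) (P q)"
    and cov: "\<And>q. q \<in> J \<Longrightarrow> covariance_mat (d q) (P q)"
    and c: "\<And>q. q \<in> J \<Longrightarrow> c q \<in> carrier_vec (d q)"
  shows "(CLINT \<omega>|M. iexp (\<Sum>q\<in>J. c q \<bullet> X q \<omega>)) =
    complex_of_real (exp (- ((\<Sum>q\<in>J. c q \<bullet> (P q *\<^sub>v c q)) / 2)))"
proof (cases "finite J")
  case False
  then show ?thesis by (simp add: prob_space)
next
  case fin: True
  define Y where "Y = (\<lambda>q \<omega>. \<Sum>j<d q. c q $ j * (\<lambda>j\<in>{..<d q}. X q \<omega> $ j) j)"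
  have Y: "Y q \<omega> = c q \<bullet> X q \<omega>" if "q \<in> J" "\<omega> \<in> space M" for q \<omega>
    using gauss[OF that(1)] that by (auto simp: Y_def scalar_prod_def gaussian_vec_def lessThan_atLeast0)
  have "indep_vars (\<lambda>q. PiM {..<d q} (\<lambda>_. borel)) (\<lambda>q \<omega>. \<lambda>j\<in>{..<d q}. X q \<omega> $ j) J"
    using ind J unfolding indep_vecs_def by (rule indep_vars_subset)
  then have indY: "indep_vars (\<lambda>_. borel) Y J"
    unfolding Y_def
    by (rule indep_vars_compose2[where Y = "\<lambda>q p. \<Sum>j<d q. c q $ j * p j"])
       (intro borel_measurable_sum borel_measurable_times borel_measurable_const measurable_component_singleton)
  have Ym: "Y q \<in> borel_measurable M" if "q \<in> J" for q
    using indY that by (auto simp: indep_vars_def)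
  have single: "char (distr M borel (Y q)) 1 = complex_of_real (exp (- ((c q \<bullet> (P q *\<^sub>v c q)) / 2)))" if q: "q \<in> J" for q
  proof -
    have "distr M borel (Y q) = distr M borel (\<lambda>\<omega>. c q \<bullet> X q \<omega>)"
      by (rule distr_cong) (auto simp: Y[OF q])
    also have "\<dots> = normal_law (c q \<bullet> 0\<^sub>v (d q)) (c q \<bullet> (P q *\<^sub>v c q))"
      using gauss[OF q] c[OF q] by (simp add: gaussian_vec_def)
    also have "c q \<bullet> 0\<^sub>v (d q) = 0" using c[OF q] by simp
    finally have "char (distr M borel (Y q)) 1 = (CLINT x|normal_law 0 (c q \<bullet> (P q *\<^sub>v c q)). iexp x)"
      by (simp add: char_def)
    also have "\<dots> = complex_of_real (exp (- ((c q \<bullet> (P q *\<^sub>v c q)) / 2)))"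
      by (rule char_normal_law) (use cov[OF q] c[OF q] in \<open>simp add: covariance_mat_def\<close>)
    finally show ?thesis .
  qed
  have "(CLINT \<omega>|M. iexp (\<Sum>q\<in>J. c q \<bullet> X q \<omega>)) = (CLINT \<omega>|M. iexp (\<Sum>q\<in>J. Y q \<omega>))"
    by (rule Bochner_Integration.integral_cong) (auto simp: Y)
  also have "\<dots> = char (distr M borel (\<lambda>\<omega>. \<Sum>q\<in>J. Y q \<omega>)) 1"
    unfolding char_def by (subst integral_distr) (use Ym in auto)
  also have "\<dots> = (\<Prod>q\<in>J. char (distr M borel (Y q)) 1)" by (rule char_distr_sum[OF indY])
  also have "\<dots> = complex_of_real (\<Prod>q\<in>J. exp (- ((c q \<bullet> (P q *\<^sub>v c q)) / 2)))"
    by (simp add: single del: of_real_exp)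
  also have "(\<Prod>q\<in>J. exp (- ((c q \<bullet> (P q *\<^sub>v c q)) / 2))) = exp (- ((\<Sum>q\<in>J. c q \<bullet> (P q *\<^sub>v c q)) / 2))"
    unfolding sum_divide_distrib sum_negf[symmetric] by (rule exp_sum[symmetric, OF fin])
  finally show ?thesis .
qed

section \<open>Measurable random vectors\<close>

text \<open>Measurability by entries, for vectors of a type that carries no sigma-algebra.\<close>

definition random_vec :: "'s measure \<Rightarrow> nat \<Rightarrow> ('s \<Rightarrow> real vec) \<Rightarrow> bool" where
  "random_vec N d F \<longleftrightarrow> (\<forall>\<omega>\<in>space N. F \<omega> \<in> carrier_vec d) \<and> (\<forall>j<d. (\<lambda>\<omega>. F \<omega> $ j) \<in> borel_measurable N)"

lemma random_vec_const: "v \<in> carrier_vec d \<Longrightarrow> random_vec N d (\<lambda>_. v)"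
  by (simp add: random_vec_def)

lemma random_vec_add:
  assumes "random_vec N d F" "random_vec N d G"
  shows "random_vec N d (\<lambda>\<omega>. F \<omega> + G \<omega>)"
proof -
  have "(\<lambda>\<omega>. (F \<omega> + G \<omega>) $ j) \<in> borel_measurable N" if "j < d" for j
  proof -
    have "(\<lambda>\<omega>. F \<omega> $ j + G \<omega> $ j) \<in> borel_measurable N"
      using assms that unfolding random_vec_def by (intro borel_measurable_add) auto
    moreover have "(F \<omega> + G \<omega>) $ j = F \<omega> $ j + G \<omega> $ j" if "\<omega> \<in> space N" for \<omega>
      using assms that \<open>j < d\<close> by (auto simp: random_vec_def)
    ultimately show ?thesis by (simp cong: measurable_cong)
  qed
  then show ?thesis using assms by (auto simp: random_vec_def)
qed

lemma random_vec_mult: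
  assumes F: "random_vec N d F" and A: "A \<in> carrier_mat e d"
  shows "random_vec N e (\<lambda>\<omega>. A *\<^sub>v F \<omega>)"
proof -
  have "(\<lambda>\<omega>. (A *\<^sub>v F \<omega>) $ j) \<in> borel_measurable N" if "j < e" for j
  proof -
    have "(\<lambda>\<omega>. \<Sum>k<d. A $$ (j, k) * F \<omega> $ k) \<in> borel_measurable N"
      using F by (auto simp: random_vec_def intro!: borel_measurable_sum borel_measurable_times)
    moreover have "(A *\<^sub>v F \<omega>) $ j = (\<Sum>k<d. A $$ (j, k) * F \<omega> $ k)" if "\<omega> \<in> space N" for \<omega>
      using F A that \<open>j < e\<close> by (auto simp: random_vec_def scalar_prod_def lessThan_atLeast0)
    ultimately show ?thesis by (simp cong: measurable_cong)
  qed
  then show ?thesis using F A by (auto simp: random_vec_def)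
qed

lemma random_vec_stack:
  assumes "\<And>x. x \<in> set xs \<Longrightarrow> random_vec N (d x) (F x)"
  shows "random_vec N (sum_list (map d xs)) (\<lambda>\<omega>. stack (map (\<lambda>x. F x \<omega>) xs))"
  using assms
proof (induction xs)
  case Nil
  then show ?case by (simp add: random_vec_def)
next
  case (Cons x xs)
  let ?n = "sum_list (map d xs)" and ?G = "\<lambda>\<omega>. stack (map (\<lambda>x. F x \<omega>) xs)"
  have F: "random_vec N (d x) (F x)" and G: "random_vec N ?n ?G" using Cons by auto
  have "(\<lambda>\<omega>. (F x \<omega> @\<^sub>v ?G \<omega>) $ j) \<in> borel_measurable N" if "j < d x + ?n" for j
  proof -
    have "(\<lambda>\<omega>. if j < d x then F x \<omega> $ j else ?G \<omega> $ (j - d x)) \<in> borel_measurable N"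
      using F G that by (cases "j < d x") (auto simp: random_vec_def)
    moreover have "(F x \<omega> @\<^sub>v ?G \<omega>) $ j = (if j < d x then F x \<omega> $ j else ?G \<omega> $ (j - d x))"
      if "\<omega> \<in> space N" for \<omega>
    proof -
      have "dim_vec (F x \<omega>) = d x" "dim_vec (?G \<omega>) = ?n"
        using F G that by (auto simp: random_vec_def)
      then show ?thesis using \<open>j < d x + ?n\<close> by simp
    qed
    ultimately show ?thesis by (simp cong: measurable_cong)
  qed
  then show ?case using F G by (auto simp: random_vec_def)
qed

section \<open>Stacked outputs of a linear system\<close>

lemma toeplitz_carrier:
  assumes "\<And>k. G k \<in> carrier_mat p q"
  shows "toeplitz T p q G \<in> carrier_mat (T * p) (T * q)"
proof -
  have "hcat p (map (\<lambda>l. if l \<le> j then G (j - l) else 0\<^sub>m p q) [1..<Suc T]) \<in> carrier_mat p (T * q)" for j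
    using hcat_carrier[of "[1..<Suc T]" "\<lambda>l. if l \<le> j then G (j - l) else 0\<^sub>m p q" p "\<lambda>_. q"] assms
    by (simp add: sum_list_triv del: upt_Suc)
  then show ?thesis
    using vcat_carrier[of "[1..<Suc T]" _ "\<lambda>_. p" "T * q"]
    unfolding toeplitz_def by (simp add: sum_list_triv del: upt_Suc)
qed

lemma toeplitz_mult_stack:
  assumes G: "\<And>k. G k \<in> carrier_mat p q" and f: "\<And>k. f k \<in> carrier_vec q"
  shows "toeplitz T p q G *\<^sub>v stack (map f [0..<T]) =
    stack (map (\<lambda>j. vec p (\<lambda>r. \<Sum>l=1..j. (G (j - l) *\<^sub>v f (l - 1)) $ r)) [1..<Suc T])"
proof -
  define H where "H = (\<lambda>j. hcat p (map (\<lambda>l. if l \<le> j then G (j - l) else 0\<^sub>m p q) [1..<Suc T]))"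
  have H: "H j \<in> carrier_mat p (T * q)" for j
    using hcat_carrier[of "[1..<Suc T]" "\<lambda>l. if l \<le> j then G (j - l) else 0\<^sub>m p q" p "\<lambda>_. q"] G
    by (simp add: H_def sum_list_triv del: upt_Suc)
  have shift: "map f [0..<T] = map (\<lambda>l. f (l - 1)) [1..<Suc T]"
    by (rule nth_equalityI) (auto simp del: upt_Suc)
  have s: "stack (map f [0..<T]) \<in> carrier_vec (T * q)"
    using stack_carrier[of "[0..<T]" f "\<lambda>_. q"] f by (simp add: sum_list_triv)
  have "H j *\<^sub>v stack (map f [0..<T]) = vec p (\<lambda>r. \<Sum>l=1..j. (G (j - l) *\<^sub>v f (l - 1)) $ r)"
    if j: "j \<in> set [1..<Suc T]" for j
  proof (rule eq_vecI)
    fix r assume "r < dim_vec (vec p (\<lambda>r. \<Sum>l=1..j. (G (j - l) *\<^sub>v f (l - 1)) $ r))"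
    then have r: "r < p" by simp
    have "(H j *\<^sub>v stack (map f [0..<T])) $ r =
        (\<Sum>l\<leftarrow>[1..<Suc T]. ((if l \<le> j then G (j - l) else 0\<^sub>m p q) *\<^sub>v f (l - 1)) $ r)"
      unfolding H_def shift by (rule hcat_mult_stack[where d = "\<lambda>_. q"]) (use G f r in auto)
    also have "\<dots> = (\<Sum>l=1..T. ((if l \<le> j then G (j - l) else 0\<^sub>m p q) *\<^sub>v f (l - 1)) $ r)"
      by (subst sum_list_distinct_conv_sum_set) (auto simp: atLeastLessThanSuc_atLeastAtMost simp del: upt_Suc)
    also have "\<dots> = (\<Sum>l=1..j. (G (j - l) *\<^sub>v f (l - 1)) $ r)"
    proof (rule sum.mono_neutral_cong_right)
      show "\<forall>l\<in>{1..T} - {1..j}. ((if l \<le> j then G (j - l) else 0\<^sub>m p q) *\<^sub>v f (l - 1)) $ r = 0"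
        using r f by (auto simp: carrier_vecD[OF f])
    qed (use j in auto)
    finally show "(H j *\<^sub>v stack (map f [0..<T])) $ r = vec p (\<lambda>r. \<Sum>l=1..j. (G (j - l) *\<^sub>v f (l - 1)) $ r) $ r"
      using r by simp
  qed (use H in auto)
  then have eq: "map (\<lambda>j. H j *\<^sub>v stack (map f [0..<T])) [1..<Suc T] =
      map (\<lambda>j. vec p (\<lambda>r. \<Sum>l=1..j. (G (j - l) *\<^sub>v f (l - 1)) $ r)) [1..<Suc T]"
    by (simp only: map_eq_conv) blast
  have "toeplitz T p q G *\<^sub>v stack (map f [0..<T]) = stack (map (\<lambda>j. H j *\<^sub>v stack (map f [0..<T])) [1..<Suc T])"
    unfolding toeplitz_def H_def[symmetric]
    by (rule vcat_mult_vec[where e = "\<lambda>_. p"]) (use H s in auto)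
  then show ?thesis unfolding eq .
qed

lemma obs_mat_carrier:
  assumes "A \<in> carrier_mat n n" "C \<in> carrier_mat p n"
  shows "obs_mat T A C \<in> carrier_mat (T * p) n"
  using vcat_carrier[of "[1..<Suc T]" "\<lambda>j. C * A ^\<^sub>m j" "\<lambda>_. p" n] assms pow_carrier_mat[OF assms(1)]
  by (simp add: obs_mat_def sum_list_triv del: upt_Suc)

lemma noise_mat_carrier:
  assumes "A \<in> carrier_mat n n" "C \<in> carrier_mat p n"
  shows "noise_mat T A C \<in> carrier_mat (T * p) (T * n)"
  using toeplitz_carrier[of "\<lambda>k. C * A ^\<^sub>m k" p n T] assms pow_carrier_mat[OF assms(1)]
  by (simp add: noise_mat_def)

lemma force_mat_carrier:
  assumes "A \<in> carrier_mat n n" "C \<in> carrier_mat p n" "B \<in> carrier_mat n q"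
  shows "force_mat T A C B \<in> carrier_mat (T * p) (T * q)"
proof -
  have "C * A ^\<^sub>m k * B \<in> carrier_mat p q" for k
    using assms(2,3) pow_carrier_mat[OF assms(1), of k] by (meson mult_carrier_mat)
  then show ?thesis using toeplitz_carrier[of "\<lambda>k. C * A ^\<^sub>m k * B" p q T] assms
    by (simp add: force_mat_def)
qed

text \<open>The input matrix can be absorbed into the signal, so that attack, interconnection and noise enter
  the stacked outputs through the same matrix.\<close>

lemma force_mat_mult_stack:
  assumes A: "A \<in> carrier_mat n n" and C: "C \<in> carrier_mat p n" and B: "B \<in> carrier_mat n q"
    and u: "\<And>k. u k \<in> carrier_vec q"
  shows "force_mat T A C B *\<^sub>v stack (map u [0..<T]) =
    noise_mat T A C *\<^sub>v stack (map (\<lambda>k. B *\<^sub>v u k) [0..<T])"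
proof -
  have G: "C * A ^\<^sub>m k \<in> carrier_mat p n" for k using A C pow_carrier_mat[OF A] by simp
  have "C * A ^\<^sub>m k * B *\<^sub>v u l = C * A ^\<^sub>m k *\<^sub>v (B *\<^sub>v u l)" for k l
    by (rule assoc_mult_mat_vec[OF G B u])
  moreover have "force_mat T A C B = toeplitz T p q (\<lambda>k. C * A ^\<^sub>m k * B)"
    "noise_mat T A C = toeplitz T p n (\<lambda>k. C * A ^\<^sub>m k)"
    using A B C by (simp_all add: force_mat_def noise_mat_def)
  moreover have "C * A ^\<^sub>m k * B \<in> carrier_mat p q" for k by (rule mult_carrier_mat[OF G B])
  moreover have "B *\<^sub>v u k \<in> carrier_vec n" for k using B u by simp
  ultimately show ?thesis
    using G u by (simp only: toeplitz_mult_stack)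
qed

text \<open>The induction shifts the trajectory by one step: \<open>x (Suc j)\<close> is the state reached after \<open>j\<close> steps from \<open>x 1\<close>.
  This needs only \<open>A\<^bsup>j+1\<^esup> = A\<^bsup>j\<^esup> A\<close>, which is how matrix powers are defined.\<close>

lemma lti_state:
  fixes A :: "real mat"
  assumes A: "A \<in> carrier_mat n n" and x: "\<And>k. x k \<in> carrier_vec n"
    and f: "\<And>k. f k \<in> carrier_vec n" and step: "\<And>k. x (Suc k) = A *\<^sub>v x k + f k"
    and C: "C \<in> carrier_mat p n" and r: "r < p"
  shows "(C *\<^sub>v x j) $ r = (C * A ^\<^sub>m j *\<^sub>v x 0) $ r + (\<Sum>l=1..j. (C * A ^\<^sub>m (j - l) *\<^sub>v f (l - 1)) $ r)"
  using x f step
proof (induction j arbitrary: x f)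
  case 0
  then show ?case using A C by simp
next
  case (Suc j)
  have P: "A ^\<^sub>m k \<in> carrier_mat n n" for k by (rule pow_carrier_mat[OF A])
  have G: "C * A ^\<^sub>m k \<in> carrier_mat p n" for k using C P by simp
  have "(C *\<^sub>v x (Suc j)) $ r = (C * A ^\<^sub>m j *\<^sub>v x (Suc 0)) $ r +
      (\<Sum>l=1..j. (C * A ^\<^sub>m (j - l) *\<^sub>v f (Suc (l - 1))) $ r)"
    by (rule Suc.IH[of "\<lambda>k. x (Suc k)" "\<lambda>k. f (Suc k)"]) (rule Suc.prems)+
  also have "C * A ^\<^sub>m j *\<^sub>v x (Suc 0) = C * A ^\<^sub>m j *\<^sub>v (A *\<^sub>v x 0) + C * A ^\<^sub>m j *\<^sub>v f 0"
    using Suc.prems G A by (simp add: mult_add_distrib_mat_vec[OF G])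
  also have "C * A ^\<^sub>m j *\<^sub>v (A *\<^sub>v x 0) = C * A ^\<^sub>m (Suc j) *\<^sub>v x 0"
    using Suc.prems(1) by (simp add: assoc_mult_mat_vec[OF G A, symmetric] assoc_mult_mat[OF C P A])
  also have "(\<Sum>l=1..j. (C * A ^\<^sub>m (j - l) *\<^sub>v f (Suc (l - 1))) $ r) =
      (\<Sum>l=Suc 1..Suc j. (C * A ^\<^sub>m (Suc j - l) *\<^sub>v f (l - 1)) $ r)"
    unfolding sum.shift_bounds_cl_Suc_ivl by (rule sum.cong) (auto simp: Suc_diff_le)
  finally have eq: "(C *\<^sub>v x (Suc j)) $ r =
      (C * A ^\<^sub>m (Suc j) *\<^sub>v x 0 + C * A ^\<^sub>m j *\<^sub>v f 0) $ r +
      (\<Sum>l=Suc 1..Suc j. (C * A ^\<^sub>m (Suc j - l) *\<^sub>v f (l - 1)) $ r)" .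
  have "(\<Sum>l=1..Suc j. (C * A ^\<^sub>m (Suc j - l) *\<^sub>v f (l - 1)) $ r) =
      (C * A ^\<^sub>m j *\<^sub>v f 0) $ r + (\<Sum>l=Suc 1..Suc j. (C * A ^\<^sub>m (Suc j - l) *\<^sub>v f (l - 1)) $ r)"
    by (subst sum.atLeast_Suc_atMost) simp_all
  moreover have "(C * A ^\<^sub>m (Suc j) *\<^sub>v x 0 + C * A ^\<^sub>m j *\<^sub>v f 0) $ r =
      (C * A ^\<^sub>m (Suc j) *\<^sub>v x 0) $ r + (C * A ^\<^sub>m j *\<^sub>v f 0) $ r"
    by (rule index_add_vec(1)) (use C r in simp)
  ultimately show ?case unfolding eq by simp
qed

lemma lti_output_stack:
  assumes A: "A \<in> carrier_mat n n" and C: "C \<in> carrier_mat p n"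
    and x: "\<And>k. x k \<in> carrier_vec n" and f: "\<And>k. f k \<in> carrier_vec n"
    and v: "\<And>k. v k \<in> carrier_vec p" and step: "\<And>k. x (Suc k) = A *\<^sub>v x k + f k"
  shows "stack (map (\<lambda>k. C *\<^sub>v x k + v k) [1..<Suc T]) =
    obs_mat T A C *\<^sub>v x 0 + noise_mat T A C *\<^sub>v stack (map f [0..<T]) + stack (map v [1..<Suc T])"
proof -
  have G: "C * A ^\<^sub>m k \<in> carrier_mat p n" for k using A C pow_carrier_mat[OF A] by simp
  define h where "h = (\<lambda>j. vec p (\<lambda>r. \<Sum>l=1..j. (C * A ^\<^sub>m (j - l) *\<^sub>v f (l - 1)) $ r))"
  have "noise_mat T A C = toeplitz T p n (\<lambda>k. C * A ^\<^sub>m k)"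
    using A C by (simp add: noise_mat_def)
  then have noise: "noise_mat T A C *\<^sub>v stack (map f [0..<T]) = stack (map h [1..<Suc T])"
    using toeplitz_mult_stack[OF G f] by (simp only: h_def)
  have obs: "obs_mat T A C *\<^sub>v x 0 = stack (map (\<lambda>j. C * A ^\<^sub>m j *\<^sub>v x 0) [1..<Suc T])"
    unfolding obs_mat_def using A by (subst vcat_mult_vec[where e = "\<lambda>_. p"]) (use G x in auto)
  have Cx: "C *\<^sub>v x j = C * A ^\<^sub>m j *\<^sub>v x 0 + h j" for j
  proof (rule eq_vecI)
    fix r assume "r < dim_vec (C * A ^\<^sub>m j *\<^sub>v x 0 + h j)"
    then have "r < p" by (simp add: h_def)
    then show "(C *\<^sub>v x j) $ r = (C * A ^\<^sub>m j *\<^sub>v x 0 + h j) $ r"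
      using lti_state[where x = x and f = f, OF A x f step C] by (simp add: h_def)
  qed (use C in \<open>simp add: h_def\<close>)
  have h: "h j \<in> carrier_vec p" for j by (simp add: h_def)
  have Gx: "C * A ^\<^sub>m j *\<^sub>v x 0 \<in> carrier_vec p" for j by (rule mult_mat_vec_carrier[OF G x])
  show ?thesis
    unfolding noise obs Cx
    by (subst stack_add[where d = "\<lambda>_. p"], use Gx h in simp, use h in simp,
        subst stack_add[where d = "\<lambda>_. p"]) (use Gx h v in auto)
qed

lemma left_null_space_annihilates:
  assumes basis: "rows_basis_of_left_null_space K M" and M: "M \<in> carrier_mat m n" and z: "z \<in> carrier_vec n"
  shows "K *\<^sub>v (M *\<^sub>v z) = 0\<^sub>v (dim_row K)"
proof (rule eq_vecI)
  interpret kernel n m "transpose_mat M" using M by unfold_locales simp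
  have Kc: "dim_col K = m" and "basis (set (rows K))"
    using basis M by (auto simp: rows_basis_of_left_null_space_def)
  then have ker: "set (rows K) \<subseteq> mat_kernel (transpose_mat M)"
    by (simp add: Ker.basis_def)
  fix i assume "i < dim_vec (0\<^sub>v (dim_row K) :: real vec)"
  then have i: "i < dim_row K" by simp
  then have "row K i \<in> mat_kernel (transpose_mat M)" using ker by (auto simp: rows_def)
  then have 0: "transpose_mat M *\<^sub>v row K i = 0\<^sub>v n"
    using mat_kernelD(2)[OF A] by blast
  have r: "row K i \<in> carrier_vec m" using i Kc by auto
  have "(K *\<^sub>v (M *\<^sub>v z)) $ i = row K i \<bullet> (M *\<^sub>v z)" using i by simp
  also have "\<dots> = (transpose_mat M *\<^sub>v row K i) \<bullet> z"
    by (rule transpose_vec_mult_scalar[symmetric, OF M z r])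
  also have "\<dots> = 0" unfolding 0 using z by simp
  finally show "(K *\<^sub>v (M *\<^sub>v z)) $ i = 0\<^sub>v (dim_row K) $ i" using i by simp
qed simp

text \<open>This is why the detectors filter their measurements: whatever enters through \<open>M\<close>, the unknown initial state
  and (for a local detector) the unknown interconnection signal, disappears.\<close>

lemma left_null_space_filter:
  assumes basis: "rows_basis_of_left_null_space K M" and M: "M \<in> carrier_mat m n"
    and z: "z \<in> carrier_vec n" and r: "r \<in> carrier_vec m"
  shows "K *\<^sub>v (M *\<^sub>v z + r) = K *\<^sub>v r"
proof -
  have K: "K \<in> carrier_mat (dim_row K) m"
    using basis M by (auto simp: rows_basis_of_left_null_space_def)
  have "K *\<^sub>v (M *\<^sub>v z + r) = 0\<^sub>v (dim_row K) + K *\<^sub>v r"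
    using M z r mult_add_distrib_mat_vec[OF K, of "M *\<^sub>v z" r] left_null_space_annihilates[OF basis M z] by simp
  also have "\<dots> = K *\<^sub>v r" using mult_mat_vec_carrier[OF K r] by simp
  finally show ?thesis .
qed

section \<open>Independence of the local detectors\<close>

locale interconnection =
  fixes S :: "'o network"
  assumes sys: "interconnected_system S"
begin

lemma pspace: "prob_space (pspace S)"
  using sys by (simp add: interconnected_system_def)

sublocale prob_space "pspace S" by (rule pspace)

lemma subs [simp]: "set (subs S) = {1..nsub S}" "distinct (subs S)"
  by (auto simp: subs_def simp del: upt_Suc)

lemma others [simp]: "set (others S i) = {1..nsub S} - {i}" "distinct (others S i)"
  by (auto simp: others_def)

lemma subsystem_wf:
  assumes "i \<in> {1..nsub S}"
  shows "\<And>j. j \<in> {1..nsub S} \<Longrightarrow> Amat S i j \<in> carrier_mat (xdim S i) (xdim S j)"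
    and "Bamat S i \<in> carrier_mat (xdim S i) (adim S i)"
    and "Cmat S i \<in> carrier_mat (ydim S i) (xdim S i)"
    and "xinit S i \<in> carrier_vec (xdim S i)"
    and "covariance_mat (xdim S i) (wcov S i)"
    and "covariance_mat (ydim S i) (vcov S i)"
    and "gaussian_vec (pspace S) (xdim S i) (wnoise S i k) (0\<^sub>v (xdim S i)) (wcov S i)"
    and "gaussian_vec (pspace S) (ydim S i) (vnoise S i k) (0\<^sub>v (ydim S i)) (vcov S i)"
  using sys assms unfolding interconnected_system_def by blast+

lemma noise_carrier:
  assumes "i \<in> {1..nsub S}" "\<omega> \<in> space (pspace S)"
  shows "wnoise S i k \<omega> \<in> carrier_vec (xdim S i)" "vnoise S i k \<omega> \<in> carrier_vec (ydim S i)"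
  using subsystem_wf(7,8)[OF assms(1), of k] assms(2) by (simp_all add: gaussian_vec_def)

lemma Bmat_carrier:
  assumes "i \<in> {1..nsub S}"
  shows "Bmat S i \<in> carrier_mat (xdim S i) (sum_list (map (xdim S) (others S i)))"
  unfolding Bmat_def by (rule hcat_carrier) (use subsystem_wf(1)[OF assms] in auto)

definition udim :: "nat \<Rightarrow> nat" where
  "udim i = sum_list (map (xdim S) (others S i))"

definition coupling :: "attack \<Rightarrow> 'o \<Rightarrow> nat \<Rightarrow> nat \<Rightarrow> real vec" where
  "coupling ua \<omega> i k = stack (map (state S ua \<omega> k) (others S i))"

lemma state_carrier:
  assumes "is_attack S ua" "\<omega> \<in> space (pspace S)" "i \<in> {1..nsub S}"
  shows "state S ua \<omega> k i \<in> carrier_vec (xdim S i)"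
proof (cases k)
  case 0
  then show ?thesis using subsystem_wf(4)[OF assms(3)] by simp
next
  case (Suc k')
  show ?thesis
    using noise_carrier(1)[OF assms(3,2), of k'] unfolding Suc by (intro carrier_vecI) simp
qed

lemma coupling_carrier:
  assumes "is_attack S ua" "\<omega> \<in> space (pspace S)"
  shows "coupling ua \<omega> i k \<in> carrier_vec (udim i)"
  unfolding coupling_def udim_def by (intro stack_carrier state_carrier[OF assms]) auto

lemma state_step:
  assumes ua: "is_attack S ua" and \<omega>: "\<omega> \<in> space (pspace S)" and i: "i \<in> {1..nsub S}"
  shows "state S ua \<omega> (Suc k) i = Amat S i i *\<^sub>v state S ua \<omega> k i +
    (Bmat S i *\<^sub>v coupling ua \<omega> i k + (Bamat S i *\<^sub>v ua i k + wnoise S i k \<omega>))"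
proof -
  let ?n = "xdim S i"
  have c: "Amat S i i *\<^sub>v state S ua \<omega> k i \<in> carrier_vec ?n"
    "Bmat S i *\<^sub>v coupling ua \<omega> i k \<in> carrier_vec ?n"
    "Bamat S i *\<^sub>v ua i k \<in> carrier_vec ?n" "wnoise S i k \<omega> \<in> carrier_vec ?n"
    using mult_mat_vec_carrier[OF subsystem_wf(1)[OF i i] state_carrier[OF ua \<omega> i]]
      mult_mat_vec_carrier[OF Bmat_carrier[OF i, folded udim_def] coupling_carrier[OF ua \<omega>]]
      mult_mat_vec_carrier[OF subsystem_wf(2)[OF i], of "ua i k"] ua i noise_carrier(1)[OF i \<omega>]
    by (auto simp: is_attack_def)
  then show ?thesis
    by (simp add: coupling_def[symmetric] assoc_add_vec[of _ ?n])
qed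

text \<open>The other subsystems act on subsystem \<open>i\<close> only through their states, and the filter removes this input
  along with the initial state. This is what makes the statistics of interacting subsystems independent.\<close>

lemma filtered_local_output:
  assumes ua: "is_attack S ua" and \<omega>: "\<omega> \<in> space (pspace S)" and i: "i \<in> {1..nsub S}"
    and K: "rows_basis_of_left_null_space K (OFl S T i)"
  shows "K *\<^sub>v Yl S T ua i \<omega> = K *\<^sub>v (noise_mat T (Amat S i i) (Cmat S i) *\<^sub>v
      stack (map (\<lambda>k. Bamat S i *\<^sub>v ua i k + wnoise S i k \<omega>) [0..<T]) +
      stack (map (\<lambda>k. vnoise S i k \<omega>) [1..<Suc T]))"
proof -
  let ?n = "xdim S i" and ?p = "ydim S i"
  define A where "A = Amat S i i"
  define C where "C = Cmat S i"
  define B where "B = Bmat S i"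
  define u where "u = coupling ua \<omega> i"
  define g where "g = (\<lambda>k. Bamat S i *\<^sub>v ua i k + wnoise S i k \<omega>)"
  define v where "v = (\<lambda>k. vnoise S i k \<omega>)"
  have A: "A \<in> carrier_mat ?n ?n" and C: "C \<in> carrier_mat ?p ?n" and B: "B \<in> carrier_mat ?n (udim i)"
    using subsystem_wf(1)[OF i i] subsystem_wf(3)[OF i] Bmat_carrier[OF i] by (simp_all add: A_def B_def C_def udim_def)
  have u: "u k \<in> carrier_vec (udim i)" for k unfolding u_def by (rule coupling_carrier[OF ua \<omega>])
  have Bu: "B *\<^sub>v u k \<in> carrier_vec ?n" for k by (rule mult_mat_vec_carrier[OF B u])
  have g: "g k \<in> carrier_vec ?n" for k
    using ua i noise_carrier(1)[OF i \<omega>] subsystem_wf(2)[OF i] by (auto simp: g_def is_attack_def)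
  have v: "v k \<in> carrier_vec ?p" for k unfolding v_def by (rule noise_carrier(2)[OF i \<omega>])
  have x: "state S ua \<omega> k i \<in> carrier_vec ?n" for k by (rule state_carrier[OF ua \<omega> i])
  have len: "stack (map f [0..<T]) \<in> carrier_vec (T * d)" if "\<And>k. f k \<in> carrier_vec d" for f d
    using stack_carrier[of "[0..<T]" f "\<lambda>_. d"] that by (simp add: sum_list_triv)
  have sv: "stack (map v [1..<Suc T]) \<in> carrier_vec (T * ?p)"
    using stack_carrier[of "[1..<Suc T]" v "\<lambda>_. ?p"] v by (simp add: sum_list_triv del: upt_Suc)
  have O: "obs_mat T A C \<in> carrier_mat (T * ?p) ?n" by (rule obs_mat_carrier[OF A C])
  have N: "noise_mat T A C \<in> carrier_mat (T * ?p) (T * ?n)" by (rule noise_mat_carrier[OF A C])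
  have F: "force_mat T A C B \<in> carrier_mat (T * ?p) (T * udim i)" by (rule force_mat_carrier[OF A C B])
  let ?OF = "hcat (T * ?p) [obs_mat T A C, force_mat T A C B]"
  have split: "noise_mat T A C *\<^sub>v stack (map (\<lambda>k. B *\<^sub>v u k + g k) [0..<T]) =
      force_mat T A C B *\<^sub>v stack (map u [0..<T]) + noise_mat T A C *\<^sub>v stack (map g [0..<T])"
    unfolding force_mat_mult_stack[OF A C B u]
    by (subst stack_add[symmetric, where d = "\<lambda>_. ?n"], use Bu in simp, use g in simp)
       (rule mult_add_distrib_mat_vec[OF N len[OF Bu] len[OF g]])
  have "Yl S T ua i \<omega> = stack (map (\<lambda>k. C *\<^sub>v state S ua \<omega> k i + v k) [1..<Suc T])"
    by (simp add: Yl_def measurement_def C_def v_def)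
  also have "\<dots> = obs_mat T A C *\<^sub>v state S ua \<omega> 0 i +
      noise_mat T A C *\<^sub>v stack (map (\<lambda>k. B *\<^sub>v u k + g k) [0..<T]) + stack (map v [1..<Suc T])"
    by (rule lti_output_stack[OF A C, where x = "\<lambda>k. state S ua \<omega> k i"])
       (use x Bu g v state_step[OF ua \<omega> i] in \<open>auto simp: A_def B_def u_def g_def\<close>)
  also have "\<dots> = ?OF *\<^sub>v (state S ua \<omega> 0 i @\<^sub>v stack (map u [0..<T])) +
      (noise_mat T A C *\<^sub>v stack (map g [0..<T]) + stack (map v [1..<Suc T]))"
    unfolding split hcat_pair_mult(2)[OF O F x len[OF u]]
    using mult_mat_vec_carrier[OF O x[of 0]] mult_mat_vec_carrier[OF F len[OF u]]
      mult_mat_vec_carrier[OF N len[OF g]] sv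
    by (simp add: assoc_add_vec[of _ "T * ?p"] del: upt_Suc)
  finally have Y: "Yl S T ua i \<omega> = \<dots>" .
  have "rows_basis_of_left_null_space K ?OF"
    using K by (simp add: OFl_def A_def B_def C_def)
  then show ?thesis
    unfolding Y A_def[symmetric] C_def[symmetric] g_def[symmetric] v_def[symmetric]
    by (rule left_null_space_filter[OF _ hcat_pair_mult(1)[OF O F x len[OF u]]])
       (use mult_mat_vec_carrier[OF N len[OF g]] sv x[of 0] len[OF u] in \<open>auto simp del: upt_Suc\<close>)
qed

text \<open>The two noise families in one index set, as required by their joint independence: \<open>Inl (i, k)\<close> is the process noise,
  \<open>Inr (i, k)\<close> the measurement noise of subsystem \<open>i\<close> at time \<open>k\<close>.\<close>

definition noise_dim :: "nat \<times> nat + nat \<times> nat \<Rightarrow> nat" where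
  "noise_dim = case_sum (\<lambda>(i, k). xdim S i) (\<lambda>(i, k). ydim S i)"

definition noise :: "nat \<times> nat + nat \<times> nat \<Rightarrow> 'o \<Rightarrow> real vec" where
  "noise = case_sum (\<lambda>(i, k). wnoise S i k) (\<lambda>(i, k). vnoise S i k)"

definition noise_cov :: "nat \<times> nat + nat \<times> nat \<Rightarrow> real mat" where
  "noise_cov = case_sum (\<lambda>(i, k). wcov S i) (\<lambda>(i, k). vcov S i)"

lemma noise_indep:
  "indep_vecs (pspace S) noise_dim noise (({1..nsub S} \<times> UNIV) <+> ({1..nsub S} \<times> UNIV))"
  using sys by (simp add: interconnected_system_def noise_dim_def noise_def)

lemma noise_gaussian:
  assumes "q \<in> ({1..nsub S} \<times> UNIV) <+> ({1..nsub S} \<times> UNIV)"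
  shows "gaussian_vec (pspace S) (noise_dim q) (noise q) (0\<^sub>v (noise_dim q)) (noise_cov q)"
    and "covariance_mat (noise_dim q) (noise_cov q)"
  using assms subsystem_wf(5-8) by (auto simp: noise_dim_def noise_def noise_cov_def)

lemma Sigmal_covariance:
  assumes i: "i \<in> {1..nsub S}" and K: "rows_basis_of_left_null_space (Nl i) (OFl S T i)"
  shows "Nl i \<in> carrier_mat (dim_row (Nl i)) (T * ydim S i)"
    and "covariance_mat (dim_row (Nl i)) (Sigmal S T Nl i)"
proof -
  have "dim_row (OFl S T i) = T * ydim S i" by (simp add: OFl_def hcat_def)
  then show N: "Nl i \<in> carrier_mat (dim_row (Nl i)) (T * ydim S i)"
    using K by (auto simp: rows_basis_of_left_null_space_def)
  show "covariance_mat (dim_row (Nl i)) (Sigmal S T Nl i)"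
    unfolding Sigmal_def
    by (rule covariance_mat_filtered_cov[OF N noise_mat_carrier[OF subsystem_wf(1)[OF i i] subsystem_wf(3)[OF i]] subsystem_wf(5,6)[OF i]])
qed

text \<open>The noises are grouped by subsystem. Groups are independent, and the \<open>i\<close>-th statistic is a measurable
  function of the \<open>i\<close>-th group. The functions \<open>L i\<close> agree with the statistics only on the sample space, outside of
  which the noise vectors need not have the right dimension.\<close>

lemma local_statistics_indep:
  assumes ua: "is_attack S ua"
    and K: "\<And>i. i \<in> {1..nsub S} \<Longrightarrow> rows_basis_of_left_null_space (Nl i) (OFl S T i)"
    and inv: "\<And>i. i \<in> {1..nsub S} \<Longrightarrow> invertible_mat (Sigmal S T Nl i)"
  obtains L where "indep_vars (\<lambda>_. borel) L {1..nsub S}"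
    "\<And>i \<omega>. i \<in> {1..nsub S} \<Longrightarrow> \<omega> \<in> space (pspace S) \<Longrightarrow> Lambdal S T Nl ua i \<omega> = L i \<omega>"
proof -
  define own where "own = (\<lambda>i::nat. ({i} \<times> (UNIV :: nat set)) <+> ({i} \<times> (UNIV :: nat set)))"
  let ?P = "\<lambda>q. PiM {..<noise_dim q} (\<lambda>_. borel :: real measure)"
  define stat where "stat = (\<lambda>i (p :: nat \<times> nat + nat \<times> nat \<Rightarrow> nat \<Rightarrow> real).
    Nl i *\<^sub>v (noise_mat T (Amat S i i) (Cmat S i) *\<^sub>v
      stack (map (\<lambda>k. Bamat S i *\<^sub>v ua i k + vec (xdim S i) (p (Inl (i, k)))) [0..<T]) +
      stack (map (\<lambda>k. vec (ydim S i) (p (Inr (i, k)))) [1..<Suc T])))"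
  define X where "X = (\<lambda>q \<omega>. \<lambda>j\<in>{..<noise_dim q}. noise q \<omega> $ j)"
  define L where "L = (\<lambda>i \<omega>. inv_quad_form (Sigmal S T Nl i) (stat i (restrict (\<lambda>q. X q \<omega>) (own i))))"
  have indX: "indep_vars ?P X (({1..nsub S} \<times> UNIV) <+> ({1..nsub S} \<times> UNIV))"
    using noise_indep by (simp add: indep_vecs_def X_def)
  have indown: "indep_vars (\<lambda>i. PiM (own i) ?P) (\<lambda>i \<omega>. restrict (\<lambda>q. X q \<omega>) (own i)) {1..nsub S}"
    by (rule indep_vars_restrict[OF indX]) (auto simp: own_def disjoint_family_on_def)
  have stat: "random_vec (PiM (own i) ?P) (dim_row (Nl i)) (stat i)" if i: "i \<in> {1..nsub S}" for i
  proof -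
    have coord: "(\<lambda>p. p q j) \<in> borel_measurable (PiM (own i) ?P)" if "q \<in> own i" "j < noise_dim q" for q j
      using measurable_compose[OF measurable_component_singleton[OF that(1), of ?P]
          measurable_component_singleton[of j "{..<noise_dim q}" "\<lambda>_. borel :: real measure"]] that(2)
      by simp
    have w: "random_vec (PiM (own i) ?P) (xdim S i) (\<lambda>p. vec (xdim S i) (p (Inl (i, k))))" for k
      using coord[of "Inl (i, k)"] by (auto simp: random_vec_def own_def noise_dim_def)
    have v: "random_vec (PiM (own i) ?P) (ydim S i) (\<lambda>p. vec (ydim S i) (p (Inr (i, k))))" for k
      using coord[of "Inr (i, k)"] by (auto simp: random_vec_def own_def noise_dim_def)
    have a: "Bamat S i *\<^sub>v ua i k \<in> carrier_vec (xdim S i)" for k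
      using mult_mat_vec_carrier[OF subsystem_wf(2)[OF i], of "ua i k"] ua i by (simp add: is_attack_def)
    have sw: "random_vec (PiM (own i) ?P) (T * xdim S i)
        (\<lambda>p. stack (map (\<lambda>k. Bamat S i *\<^sub>v ua i k + vec (xdim S i) (p (Inl (i, k)))) [0..<T]))"
      using random_vec_stack[of "[0..<T]" "PiM (own i) ?P" "\<lambda>_. xdim S i"
          "\<lambda>k p. Bamat S i *\<^sub>v ua i k + vec (xdim S i) (p (Inl (i, k)))"]
        random_vec_add[OF random_vec_const[OF a] w] by (simp add: sum_list_triv)
    have sv: "random_vec (PiM (own i) ?P) (T * ydim S i)
        (\<lambda>p. stack (map (\<lambda>k. vec (ydim S i) (p (Inr (i, k)))) [1..<Suc T]))"
      using random_vec_stack[of "[1..<Suc T]" "PiM (own i) ?P" "\<lambda>_. ydim S i"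
          "\<lambda>k p. vec (ydim S i) (p (Inr (i, k)))"] v by (simp add: sum_list_triv del: upt_Suc)
    show ?thesis
      unfolding stat_def
      by (rule random_vec_mult[OF random_vec_add[OF random_vec_mult[OF sw
            noise_mat_carrier[OF subsystem_wf(1)[OF i i] subsystem_wf(3)[OF i]]] sv] Sigmal_covariance(1)[where Nl = Nl, OF i K[OF i]]])
  qed
  have meas: "(\<lambda>p. inv_quad_form (Sigmal S T Nl i) (stat i p)) \<in> borel_measurable (PiM (own i) ?P)"
    if i: "i \<in> {1..nsub S}" for i
  proof -
    note cov = Sigmal_covariance(2)[where Nl = Nl, OF i K[OF i]]
    have Sc: "Sigmal S T Nl i \<in> carrier_mat (dim_row (Nl i)) (dim_row (Nl i))"
      using cov by (simp add: covariance_mat_def)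
    obtain W where W: "W \<in> carrier_mat (dim_row (Nl i)) (dim_row (Nl i))"
      "W * Sigmal S T Nl i * transpose_mat W = 1\<^sub>m (dim_row (Nl i))"
      by (rule whitening[OF cov inv[OF i]])
    have "random_vec (PiM (own i) ?P) (dim_row (Nl i)) (\<lambda>p. W *\<^sub>v stat i p)"
      by (rule random_vec_mult[OF stat[OF i] W(1)])
    then have "(\<lambda>p. \<Sum>j<dim_row (Nl i). ((W *\<^sub>v stat i p) $ j)\<^sup>2) \<in> borel_measurable (PiM (own i) ?P)"
      unfolding random_vec_def by (intro borel_measurable_sum borel_measurable_power) auto
    moreover have "inv_quad_form (Sigmal S T Nl i) (stat i p) = (\<Sum>j<dim_row (Nl i). ((W *\<^sub>v stat i p) $ j)\<^sup>2)"
      if "p \<in> space (PiM (own i) ?P)" for p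
      by (rule inv_quad_form_whitened[OF Sc W]) (use stat[OF i] that in \<open>simp add: random_vec_def\<close>)
    ultimately show ?thesis by (simp cong: measurable_cong)
  qed
  have "indep_vars (\<lambda>_. borel) L {1..nsub S}"
    unfolding L_def
    by (rule indep_vars_compose2[OF indown, where Y = "\<lambda>i p. inv_quad_form (Sigmal S T Nl i) (stat i p)"]) (rule meas)
  moreover have "Lambdal S T Nl ua i \<omega> = L i \<omega>" if i: "i \<in> {1..nsub S}" and \<omega>: "\<omega> \<in> space (pspace S)" for i \<omega>
  proof -
    have "vec (xdim S i) (restrict (\<lambda>q. X q \<omega>) (own i) (Inl (i, k))) = wnoise S i k \<omega>"
      "vec (ydim S i) (restrict (\<lambda>q. X q \<omega>) (own i) (Inr (i, k))) = vnoise S i k \<omega>" for k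
      using noise_carrier[OF i \<omega>, of k] by (auto simp: own_def X_def noise_def noise_dim_def)
    then show ?thesis
      unfolding Lambdal_def L_def stat_def filtered_local_output[OF ua \<omega> i K[OF i]] by simp
  qed
  ultimately show ?thesis using that by blast
qed

lemma alarm_prob_decentral_eq:
  assumes ua: "is_attack S ua"
    and K: "\<And>i. i \<in> {1..nsub S} \<Longrightarrow> rows_basis_of_left_null_space (Nl i) (OFl S T i)"
    and inv: "\<And>i. i \<in> {1..nsub S} \<Longrightarrow> invertible_mat (Sigmal S T Nl i)"
  shows "1 - alarm_prob_decentral S T Nl \<tau> ua = (\<Prod>i\<in>{1..nsub S}. 1 - alarm_prob_local S T Nl \<tau> ua i)"
proof -
  obtain L where ind: "indep_vars (\<lambda>_. borel) L {1..nsub S}"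
    and L: "\<And>i \<omega>. i \<in> {1..nsub S} \<Longrightarrow> \<omega> \<in> space (pspace S) \<Longrightarrow> Lambdal S T Nl ua i \<omega> = L i \<omega>"
    using local_statistics_indep[OF ua K inv] by blast
  have Lm: "L i \<in> borel_measurable (pspace S)" if "i \<in> {1..nsub S}" for i
    using ind that by (auto simp: indep_vars_def)
  have N: "{1..nsub S} \<noteq> {}" using sys by (simp add: interconnected_system_def)
  have ev: "{\<omega> \<in> space (pspace S). L i \<omega> \<ge> \<tau> i} \<in> events" if "i \<in> {1..nsub S}" for i
    using Lm[OF that] by measurable
  have evU: "{\<omega> \<in> space (pspace S). \<exists>i\<in>{1..nsub S}. L i \<omega> \<ge> \<tau> i} \<in> events"
  proof -
    have "{\<omega> \<in> space (pspace S). \<exists>i\<in>{1..nsub S}. L i \<omega> \<ge> \<tau> i} =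
        (\<Union>i\<in>{1..nsub S}. {\<omega> \<in> space (pspace S). L i \<omega> \<ge> \<tau> i})" by auto
    then show ?thesis using ev by auto
  qed
  have "1 - alarm_prob_decentral S T Nl \<tau> ua =
      1 - prob {\<omega> \<in> space (pspace S). \<exists>i\<in>{1..nsub S}. L i \<omega> \<ge> \<tau> i}"
    unfolding alarm_prob_decentral_def using L by (metis (mono_tags, lifting) Collect_cong)
  also have "\<dots> = prob (space (pspace S) - {\<omega> \<in> space (pspace S). \<exists>i\<in>{1..nsub S}. L i \<omega> \<ge> \<tau> i})"
    by (rule prob_compl[symmetric, OF evU])
  also have "space (pspace S) - {\<omega> \<in> space (pspace S). \<exists>i\<in>{1..nsub S}. L i \<omega> \<ge> \<tau> i} =
      (\<Inter>i\<in>{1..nsub S}. L i -` {..<\<tau> i} \<inter> space (pspace S))"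
    using N by (auto simp: not_le)
  also have "prob \<dots> = (\<Prod>i\<in>{1..nsub S}. prob (L i -` {..<\<tau> i} \<inter> space (pspace S)))"
    by (rule indep_varsD_finite[OF ind N]) auto
  also have "\<dots> = (\<Prod>i\<in>{1..nsub S}. 1 - alarm_prob_local S T Nl \<tau> ua i)"
  proof (rule prod.cong)
    fix i assume i: "i \<in> {1..nsub S}"
    have "L i -` {..<\<tau> i} \<inter> space (pspace S) =
        space (pspace S) - {\<omega> \<in> space (pspace S). L i \<omega> \<ge> \<tau> i}" by auto
    then have "prob (L i -` {..<\<tau> i} \<inter> space (pspace S)) = 1 - prob {\<omega> \<in> space (pspace S). L i \<omega> \<ge> \<tau> i}"
      using prob_compl[OF ev[OF i]] by simp
    also have "{\<omega> \<in> space (pspace S). L i \<omega> \<ge> \<tau> i} = {\<omega> \<in> space (pspace S). Lambdal S T Nl ua i \<omega> \<ge> \<tau> i}"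
      using L[OF i] by auto
    finally show "prob (L i -` {..<\<tau> i} \<inter> space (pspace S)) = 1 - alarm_prob_local S T Nl \<tau> ua i"
      by (simp add: alarm_prob_local_def)
  qed simp
  finally show ?thesis .
qed

section \<open>The missed detections of the centralized detector\<close>

definition xc :: nat where "xc = sum_list (map (xdim S) (subs S))"

definition yc :: nat where "yc = sum_list (map (ydim S) (subs S))"

definition ac :: nat where "ac = sum_list (map (adim S) (subs S))"

lemma central_carriers:
  "Ac S \<in> carrier_mat xc xc" "Cc S \<in> carrier_mat yc xc" "Bac S \<in> carrier_mat xc ac"
  "covariance_mat xc (wcovc S)" "covariance_mat yc (vcovc S)"
proof -
  have "hcat (xdim S i) (map (Amat S i) (subs S)) \<in> carrier_mat (xdim S i) xc" if "i \<in> {1..nsub S}" for i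
    unfolding xc_def by (rule hcat_carrier) (use subsystem_wf(1)[OF that] in auto)
  then show "Ac S \<in> carrier_mat xc xc"
    unfolding Ac_def xc_def by (intro vcat_carrier) auto
  show "Cc S \<in> carrier_mat yc xc"
    unfolding Cc_def xc_def yc_def by (rule diag_block_mat_carrier) (use subsystem_wf(3) in auto)
  show "Bac S \<in> carrier_mat xc ac"
    unfolding Bac_def xc_def ac_def by (rule diag_block_mat_carrier) (use subsystem_wf(2) in auto)
  show "covariance_mat xc (wcovc S)" "covariance_mat yc (vcovc S)"
    unfolding wcovc_def vcovc_def xc_def yc_def
    by (rule covariance_mat_diag_block[OF subs(2)], use subsystem_wf(5,6) in auto)+
qed

lemma Ac_mult_stack:
  assumes x: "\<And>j. j \<in> {1..nsub S} \<Longrightarrow> x j \<in> carrier_vec (xdim S j)"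
  shows "Ac S *\<^sub>v stack (map x (subs S)) =
    stack (map (\<lambda>i. Amat S i i *\<^sub>v x i + Bmat S i *\<^sub>v stack (map x (others S i))) (subs S))"
proof -
  let ?H = "\<lambda>i. hcat (xdim S i) (map (Amat S i) (subs S))"
  have s: "stack (map x (subs S)) \<in> carrier_vec xc"
    unfolding xc_def by (rule stack_carrier) (use x in auto)
  have H: "?H i \<in> carrier_mat (xdim S i) xc" if "i \<in> {1..nsub S}" for i
    unfolding xc_def by (rule hcat_carrier) (use subsystem_wf(1)[OF that] in auto)
  have "Ac S *\<^sub>v stack (map x (subs S)) = stack (map (\<lambda>i. ?H i *\<^sub>v stack (map x (subs S))) (subs S))"
    unfolding Ac_def xc_def[symmetric]
    by (rule vcat_mult_vec[where e = "xdim S"]) (use H s in auto)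
  also have "map (\<lambda>i. ?H i *\<^sub>v stack (map x (subs S))) (subs S) =
      map (\<lambda>i. Amat S i i *\<^sub>v x i + Bmat S i *\<^sub>v stack (map x (others S i))) (subs S)"
  proof (rule map_cong[OF refl])
    fix i assume "i \<in> set (subs S)"
    then have i: "i \<in> {1..nsub S}" by simp
    show "?H i *\<^sub>v stack (map x (subs S)) = Amat S i i *\<^sub>v x i + Bmat S i *\<^sub>v stack (map x (others S i))"
    proof (rule eq_vecI)
      fix r assume "r < dim_vec (Amat S i i *\<^sub>v x i + Bmat S i *\<^sub>v stack (map x (others S i)))"
      then have r: "r < xdim S i" using Bmat_carrier[OF i] by simp
      have "(?H i *\<^sub>v stack (map x (subs S))) $ r = (\<Sum>j\<leftarrow>subs S. (Amat S i j *\<^sub>v x j) $ r)"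
        by (rule hcat_mult_stack[where d = "xdim S"]) (use subsystem_wf(1)[OF i] x r in auto)
      also have "\<dots> = (\<Sum>j\<in>{1..nsub S}. (Amat S i j *\<^sub>v x j) $ r)"
        by (simp add: sum_list_distinct_conv_sum_set)
      also have "\<dots> = (Amat S i i *\<^sub>v x i) $ r + (\<Sum>j\<in>{1..nsub S} - {i}. (Amat S i j *\<^sub>v x j) $ r)"
        by (rule sum.remove) (use i in auto)
      also have "(\<Sum>j\<in>{1..nsub S} - {i}. (Amat S i j *\<^sub>v x j) $ r) = (\<Sum>j\<leftarrow>others S i. (Amat S i j *\<^sub>v x j) $ r)"
        by (simp add: sum_list_distinct_conv_sum_set)
      also have "\<dots> = (Bmat S i *\<^sub>v stack (map x (others S i))) $ r"
        unfolding Bmat_def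
        by (rule hcat_mult_stack[symmetric, where d = "xdim S"]) (use subsystem_wf(1)[OF i] x r in auto)
      finally show "(?H i *\<^sub>v stack (map x (subs S))) $ r =
          (Amat S i i *\<^sub>v x i + Bmat S i *\<^sub>v stack (map x (others S i))) $ r"
        using r Bmat_carrier[OF i] by simp
    qed (use H[OF i] Bmat_carrier[OF i] in simp)
  qed
  finally show ?thesis .
qed

lemma filtered_central_output:
  assumes ua: "is_attack S ua" and \<omega>: "\<omega> \<in> space (pspace S)"
    and K: "rows_basis_of_left_null_space K (Oc S T)"
  shows "K *\<^sub>v Yc S T ua \<omega> = betac S T K ua + K *\<^sub>v (noise_mat T (Ac S) (Cc S) *\<^sub>v
      stack2 (\<lambda>k i. wnoise S i k \<omega>) [0..<T] (subs S) + stack2 (\<lambda>k i. vnoise S i k \<omega>) [1..<Suc T] (subs S))"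
proof -
  note A = central_carriers(1) and C = central_carriers(2) and B = central_carriers(3)
  define x where "x = (\<lambda>k. stack (map (state S ua \<omega> k) (subs S)))"
  define u where "u = (\<lambda>k. stack (map (\<lambda>i. ua i k) (subs S)))"
  define w where "w = (\<lambda>k. stack (map (\<lambda>i. wnoise S i k \<omega>) (subs S)))"
  define v where "v = (\<lambda>k. stack (map (\<lambda>i. vnoise S i k \<omega>) (subs S)))"
  have uai: "ua i k \<in> carrier_vec (adim S i)" if "i \<in> {1..nsub S}" for i k
    using ua that by (simp add: is_attack_def)
  have x: "x k \<in> carrier_vec xc" for k
    unfolding x_def xc_def by (rule stack_carrier) (use state_carrier[OF ua \<omega>] in auto)
  have u: "u k \<in> carrier_vec ac" for k
    unfolding u_def ac_def by (rule stack_carrier) (use uai in auto)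
  have w: "w k \<in> carrier_vec xc" for k
    unfolding w_def xc_def by (rule stack_carrier) (use noise_carrier(1)[OF _ \<omega>] in auto)
  have v: "v k \<in> carrier_vec yc" for k
    unfolding v_def yc_def by (rule stack_carrier) (use noise_carrier(2)[OF _ \<omega>] in auto)
  have Bu: "Bac S *\<^sub>v u k \<in> carrier_vec xc" for k by (rule mult_mat_vec_carrier[OF B u])
  have step: "x (Suc k) = Ac S *\<^sub>v x k + (Bac S *\<^sub>v u k + w k)" for k
  proof -
    have c: "Amat S i i *\<^sub>v state S ua \<omega> k i + Bmat S i *\<^sub>v stack (map (state S ua \<omega> k) (others S i)) \<in> carrier_vec (xdim S i)"
      "Bamat S i *\<^sub>v ua i k \<in> carrier_vec (xdim S i)"
      if i: "i \<in> {1..nsub S}" for i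
      using mult_mat_vec_carrier[OF Bmat_carrier[OF i, folded udim_def]
          coupling_carrier[OF ua \<omega>, unfolded coupling_def], of k]
        mult_mat_vec_carrier[OF subsystem_wf(1)[OF i i] state_carrier[OF ua \<omega> i], of k]
        mult_mat_vec_carrier[OF subsystem_wf(2)[OF i] uai[OF i], of k]
      by (simp_all only: add_carrier_vec)
    have "Ac S *\<^sub>v x k = stack (map (\<lambda>i. Amat S i i *\<^sub>v state S ua \<omega> k i +
        Bmat S i *\<^sub>v stack (map (state S ua \<omega> k) (others S i))) (subs S))"
      unfolding x_def by (rule Ac_mult_stack) (rule state_carrier[OF ua \<omega>])
    moreover have "Bac S *\<^sub>v u k = stack (map (\<lambda>i. Bamat S i *\<^sub>v ua i k) (subs S))"
      unfolding Bac_def u_def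
      by (rule diag_block_mat_mult_stack[where d = "adim S" and e = "xdim S"]) (use subsystem_wf(2) uai in auto)
    moreover have "stack (map (\<lambda>i. Bamat S i *\<^sub>v ua i k) (subs S)) + w k =
        stack (map (\<lambda>i. Bamat S i *\<^sub>v ua i k + wnoise S i k \<omega>) (subs S))"
      unfolding w_def by (rule stack_add[where d = "xdim S"]) (use c noise_carrier(1)[OF _ \<omega>] in auto)
    moreover have "stack (map (\<lambda>i. Amat S i i *\<^sub>v state S ua \<omega> k i +
        Bmat S i *\<^sub>v stack (map (state S ua \<omega> k) (others S i))) (subs S)) +
        stack (map (\<lambda>i. Bamat S i *\<^sub>v ua i k + wnoise S i k \<omega>) (subs S)) =
        stack (map (\<lambda>i. (Amat S i i *\<^sub>v state S ua \<omega> k i + Bmat S i *\<^sub>v stack (map (state S ua \<omega> k) (others S i))) +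
          (Bamat S i *\<^sub>v ua i k + wnoise S i k \<omega>)) (subs S))"
      by (rule stack_add[where d = "xdim S"], use c in simp)
         (use c noise_carrier(1)[OF _ \<omega>] in \<open>auto intro!: add_carrier_vec\<close>)
    moreover have "map (\<lambda>i. (Amat S i i *\<^sub>v state S ua \<omega> k i + Bmat S i *\<^sub>v stack (map (state S ua \<omega> k) (others S i))) +
          (Bamat S i *\<^sub>v ua i k + wnoise S i k \<omega>)) (subs S) = map (state S ua \<omega> (Suc k)) (subs S)"
    proof (rule map_cong[OF refl])
      fix i assume "i \<in> set (subs S)"
      then have i: "i \<in> {1..nsub S}" by simp
      show "(Amat S i i *\<^sub>v state S ua \<omega> k i + Bmat S i *\<^sub>v stack (map (state S ua \<omega> k) (others S i))) +
          (Bamat S i *\<^sub>v ua i k + wnoise S i k \<omega>) = state S ua \<omega> (Suc k) i"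
        by (simp add: assoc_add_vec[OF c(1)[OF i] c(2)[OF i] noise_carrier(1)[OF i \<omega>]])
    qed
    ultimately show ?thesis unfolding x_def by simp
  qed
  have len: "stack (map f [0..<T]) \<in> carrier_vec (T * d)" if "\<And>k. f k \<in> carrier_vec d" for f d
    using stack_carrier[of "[0..<T]" f "\<lambda>_. d"] that by (simp add: sum_list_triv)
  have sv: "stack (map v [1..<Suc T]) \<in> carrier_vec (T * yc)"
    using stack_carrier[of "[1..<Suc T]" v "\<lambda>_. yc"] v by (simp add: sum_list_triv del: upt_Suc)
  have O: "Oc S T \<in> carrier_mat (T * yc) xc" unfolding Oc_def by (rule obs_mat_carrier[OF A C])
  have N: "noise_mat T (Ac S) (Cc S) \<in> carrier_mat (T * yc) (T * xc)" by (rule noise_mat_carrier[OF A C])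
  have F: "force_mat T (Ac S) (Cc S) (Bac S) \<in> carrier_mat (T * yc) (T * ac)" by (rule force_mat_carrier[OF A C B])
  have Kc: "K \<in> carrier_mat (dim_row K) (T * yc)"
    using K O by (auto simp: rows_basis_of_left_null_space_def)
  have meas: "stack (map (measurement S ua \<omega> k) (subs S)) = Cc S *\<^sub>v x k + v k" for k
  proof -
    have "Cc S *\<^sub>v x k = stack (map (\<lambda>i. Cmat S i *\<^sub>v state S ua \<omega> k i) (subs S))"
      unfolding Cc_def x_def
      by (rule diag_block_mat_mult_stack[where d = "xdim S" and e = "ydim S"]) (use subsystem_wf(3) state_carrier[OF ua \<omega>] in auto)
    then have "Cc S *\<^sub>v x k + v k = stack (map (\<lambda>i. Cmat S i *\<^sub>v state S ua \<omega> k i + vnoise S i k \<omega>) (subs S))"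
      unfolding v_def
      by (simp only:) (rule stack_add[where d = "ydim S"], use mult_mat_vec_carrier[OF subsystem_wf(3) state_carrier[OF ua \<omega>]] noise_carrier(2)[OF _ \<omega>] in auto)
    also have "(\<lambda>i. Cmat S i *\<^sub>v state S ua \<omega> k i + vnoise S i k \<omega>) = measurement S ua \<omega> k"
      by (simp add: measurement_def fun_eq_iff)
    finally show ?thesis by simp
  qed
  have split: "noise_mat T (Ac S) (Cc S) *\<^sub>v stack (map (\<lambda>k. Bac S *\<^sub>v u k + w k) [0..<T]) =
      force_mat T (Ac S) (Cc S) (Bac S) *\<^sub>v stack (map u [0..<T]) + noise_mat T (Ac S) (Cc S) *\<^sub>v stack (map w [0..<T])"
    unfolding force_mat_mult_stack[OF A C B u]
    by (subst stack_add[symmetric, where d = "\<lambda>_. xc"], use Bu in simp, use w in simp)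
       (rule mult_add_distrib_mat_vec[OF N len[OF Bu] len[OF w]])
  have Fu: "force_mat T (Ac S) (Cc S) (Bac S) *\<^sub>v stack (map u [0..<T]) \<in> carrier_vec (T * yc)"
    by (rule mult_mat_vec_carrier[OF F len[OF u]])
  have Nw: "noise_mat T (Ac S) (Cc S) *\<^sub>v stack (map w [0..<T]) \<in> carrier_vec (T * yc)"
    by (rule mult_mat_vec_carrier[OF N len[OF w]])
  have Ox: "Oc S T *\<^sub>v x 0 \<in> carrier_vec (T * yc)" by (rule mult_mat_vec_carrier[OF O x])
  have "Yc S T ua \<omega> = stack (map (\<lambda>k. Cc S *\<^sub>v x k + v k) [1..<Suc T])"
    by (simp only: Yc_def meas)
  also have "\<dots> = Oc S T *\<^sub>v x 0 + noise_mat T (Ac S) (Cc S) *\<^sub>v stack (map (\<lambda>k. Bac S *\<^sub>v u k + w k) [0..<T]) +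
      stack (map v [1..<Suc T])"
    unfolding Oc_def by (rule lti_output_stack[where x = x and v = v, OF A C x add_carrier_vec[OF Bu w] v step])
  also have "\<dots> = Oc S T *\<^sub>v x 0 + (force_mat T (Ac S) (Cc S) (Bac S) *\<^sub>v stack (map u [0..<T]) +
      (noise_mat T (Ac S) (Cc S) *\<^sub>v stack (map w [0..<T]) + stack (map v [1..<Suc T])))"
    unfolding split using Ox Fu Nw sv by (simp add: assoc_add_vec[of _ "T * yc"] del: upt_Suc)
  also have "K *\<^sub>v \<dots> = K *\<^sub>v (force_mat T (Ac S) (Cc S) (Bac S) *\<^sub>v stack (map u [0..<T]) +
      (noise_mat T (Ac S) (Cc S) *\<^sub>v stack (map w [0..<T]) + stack (map v [1..<Suc T])))"
    by (rule left_null_space_filter[OF K O x]) (use Fu Nw sv in \<open>simp del: upt_Suc\<close>)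
  also have "\<dots> = K *\<^sub>v (force_mat T (Ac S) (Cc S) (Bac S) *\<^sub>v stack (map u [0..<T])) +
      K *\<^sub>v (noise_mat T (Ac S) (Cc S) *\<^sub>v stack (map w [0..<T]) + stack (map v [1..<Suc T]))"
    by (rule mult_add_distrib_mat_vec[OF Kc Fu]) (use Nw sv in \<open>simp del: upt_Suc\<close>)
  also have "K *\<^sub>v (force_mat T (Ac S) (Cc S) (Bac S) *\<^sub>v stack (map u [0..<T])) = betac S T K ua"
    by (simp only: betac_def Uc_def u_def)
  finally show ?thesis by (simp only: w_def v_def)
qed

lemma Sigmac_covariance:
  assumes K: "rows_basis_of_left_null_space K (Oc S T)"
  shows "K \<in> carrier_mat (dim_row K) (T * yc)"
    and "covariance_mat (dim_row K) (Sigmac S T K)"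
proof -
  have "dim_row (Oc S T) = T * yc"
    unfolding Oc_def by (rule carrier_matD(1)[OF obs_mat_carrier[OF central_carriers(1,2)]])
  then show Kc: "K \<in> carrier_mat (dim_row K) (T * yc)"
    using K by (auto simp: rows_basis_of_left_null_space_def)
  show "covariance_mat (dim_row K) (Sigmac S T K)"
    unfolding Sigmac_def
    by (rule covariance_mat_filtered_cov[OF Kc noise_mat_carrier[OF central_carriers(1,2)] central_carriers(4,5)])
qed

text \<open>Process noise acts from time \<open>0\<close> to \<open>T - 1\<close>, measurement noise from \<open>1\<close> to \<open>T\<close>.\<close>

definition horizon_noises :: "nat \<Rightarrow> (nat \<times> nat + nat \<times> nat) set" where
  "horizon_noises T = ({1..nsub S} \<times> {0..<T}) <+> ({1..nsub S} \<times> {1..<Suc T})"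

text \<open>The weights \<open>c\<close> come from transposing: those of the measurement noise are the blocks of \<open>K\<^sup>T a\<close>, those of the
  process noise the blocks of \<open>N\<^sup>T K\<^sup>T a\<close>, where \<open>N\<close> maps process noise to outputs. The same weights give the
  fluctuation about the mean and its variance, which identifies the characteristic function of the filtered measurements.\<close>

lemma central_functional:
  assumes ua: "is_attack S ua" and K: "rows_basis_of_left_null_space K (Oc S T)"
    and a: "a \<in> carrier_vec (dim_row K)"
  obtains c where "\<And>q. q \<in> horizon_noises T \<Longrightarrow> c q \<in> carrier_vec (noise_dim q)"
    and "\<And>\<omega>. \<omega> \<in> space (pspace S) \<Longrightarrow>
      a \<bullet> (K *\<^sub>v Yc S T ua \<omega>) = a \<bullet> betac S T K ua + (\<Sum>q\<in>horizon_noises T. c q \<bullet> noise q \<omega>)"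
    and "a \<bullet> (Sigmac S T K *\<^sub>v a) = (\<Sum>q\<in>horizon_noises T. c q \<bullet> (noise_cov q *\<^sub>v c q))"
proof -
  define N where "N = noise_mat T (Ac S) (Cc S)"
  have N: "N \<in> carrier_mat (T * yc) (T * xc)"
    unfolding N_def by (rule noise_mat_carrier[OF central_carriers(1,2)])
  note Kc = Sigmac_covariance(1)[OF K]
  define b where "b = transpose_mat K *\<^sub>v a"
  define g where "g = transpose_mat N *\<^sub>v b"
  have b: "b \<in> carrier_vec (T * yc)" 
    unfolding b_def by (rule mult_mat_vec_carrier[OF iffD2[OF transpose_carrier_mat Kc] a])
  have g: "g \<in> carrier_vec (T * xc)" 
    unfolding g_def by (rule mult_mat_vec_carrier[OF iffD2[OF transpose_carrier_mat N] b])
  have g': "g \<in> carrier_vec (length [0..<T] * sum_list (map (xdim S) (subs S)))"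
    and b': "b \<in> carrier_vec (length [1..<Suc T] * sum_list (map (ydim S) (subs S)))"
    using g b by (simp_all add: xc_def yc_def del: upt_Suc)
  obtain cw where cw: "\<forall>k\<in>set [0..<T]. \<forall>i\<in>set (subs S). cw k i \<in> carrier_vec (xdim S i)"
    "g = stack2 cw [0..<T] (subs S)"
    by (rule stack2_decompose[OF distinct_upt subs(2) g']) blast
  obtain cv where cv: "\<forall>k\<in>set [1..<Suc T]. \<forall>i\<in>set (subs S). cv k i \<in> carrier_vec (ydim S i)"
    "b = stack2 cv [1..<Suc T] (subs S)"
    by (rule stack2_decompose[OF distinct_upt subs(2) b']) blast
  define c where "c = case_sum (\<lambda>(i, k). cw k i) (\<lambda>(i, k). cv k i)"
  have plus: "(\<Sum>q\<in>horizon_noises T. f q) = (\<Sum>(i, k)\<in>{1..nsub S} \<times> {0..<T}. f (Inl (i, k))) +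
      (\<Sum>(i, k)\<in>{1..nsub S} \<times> {1..<Suc T}. f (Inr (i, k)))" for f :: "_ \<Rightarrow> real"
    unfolding horizon_noises_def by (subst sum.Plus) (simp_all add: o_def case_prod_unfold)
  show ?thesis
  proof (rule that[of c])
    show "c q \<in> carrier_vec (noise_dim q)" if "q \<in> horizon_noises T" for q
      using that cw(1) cv(1) by (auto simp: horizon_noises_def c_def noise_dim_def simp del: upt_Suc)
    show "a \<bullet> (K *\<^sub>v Yc S T ua \<omega>) = a \<bullet> betac S T K ua + (\<Sum>q\<in>horizon_noises T. c q \<bullet> noise q \<omega>)"
      if \<omega>: "\<omega> \<in> space (pspace S)" for \<omega>
    proof -
      define W where "W = stack2 (\<lambda>k i. wnoise S i k \<omega>) [0..<T] (subs S)"
      define V where "V = stack2 (\<lambda>k i. vnoise S i k \<omega>) [1..<Suc T] (subs S)"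
      have W: "W \<in> carrier_vec (T * xc)"
        using stack_carrier[of "[0..<T]" "\<lambda>k. stack (map (\<lambda>i. wnoise S i k \<omega>) (subs S))" "\<lambda>_. xc"]
          stack_carrier[of "subs S" "\<lambda>i. wnoise S i _ \<omega>" "xdim S"] noise_carrier(1)[OF _ \<omega>]
        by (simp add: W_def sum_list_triv xc_def)
      have V: "V \<in> carrier_vec (T * yc)"
        using stack_carrier[of "[1..<Suc T]" "\<lambda>k. stack (map (\<lambda>i. vnoise S i k \<omega>) (subs S))" "\<lambda>_. yc"]
          stack_carrier[of "subs S" "\<lambda>i. vnoise S i _ \<omega>" "ydim S"] noise_carrier(2)[OF _ \<omega>]
        by (simp add: V_def sum_list_triv yc_def del: upt_Suc)
      have NW: "N *\<^sub>v W \<in> carrier_vec (T * yc)" by (rule mult_mat_vec_carrier[OF N W])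
      have sum: "N *\<^sub>v W + V \<in> carrier_vec (T * yc)" using NW V by simp
      have beta: "betac S T K ua \<in> carrier_vec (dim_row K)"
        by (rule carrier_vecI) (simp add: betac_def)
      have "a \<bullet> (K *\<^sub>v Yc S T ua \<omega>) = a \<bullet> betac S T K ua + a \<bullet> (K *\<^sub>v (N *\<^sub>v W + V))"
        unfolding filtered_central_output[OF ua \<omega> K] W_def[symmetric] V_def[symmetric] N_def[symmetric]
        by (rule scalar_prod_add_distrib[OF a beta mult_mat_vec_carrier[OF Kc sum]])
      also have "a \<bullet> (K *\<^sub>v (N *\<^sub>v W + V)) = b \<bullet> (N *\<^sub>v W + V)"
        unfolding b_def by (rule transpose_vec_mult_scalar[symmetric, OF Kc sum a])
      also have "\<dots> = b \<bullet> (N *\<^sub>v W) + b \<bullet> V" by (rule scalar_prod_add_distrib[OF b NW V])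
      also have "b \<bullet> (N *\<^sub>v W) = g \<bullet> W"
        unfolding g_def by (rule transpose_vec_mult_scalar[symmetric, OF N W b])
      also have "g \<bullet> W = (\<Sum>(i, k)\<in>set (subs S) \<times> set [0..<T]. cw k i \<bullet> wnoise S i k \<omega>)"
        unfolding cw(2) W_def
        by (rule stack2_scalar_prod[where d = "xdim S"]) (use cw(1) noise_carrier(1)[OF _ \<omega>] in auto)
      also have "b \<bullet> V = (\<Sum>(i, k)\<in>set (subs S) \<times> set [1..<Suc T]. cv k i \<bullet> vnoise S i k \<omega>)"
        unfolding cv(2) V_def
        by (rule stack2_scalar_prod[where d = "ydim S"]) (use cv(1) noise_carrier(2)[OF _ \<omega>] in \<open>auto simp del: upt_Suc\<close>)
      finally show ?thesis unfolding plus by (simp add: c_def noise_def del: upt_Suc)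
    qed
    have wc: "wcov S i \<in> carrier_mat (xdim S i) (xdim S i)" "vcov S i \<in> carrier_mat (ydim S i) (ydim S i)"
      if "i \<in> {1..nsub S}" for i
      using subsystem_wf(5,6)[OF that] by (simp_all add: covariance_mat_def)
    have Pw: "wcov S i *\<^sub>v cw k i \<in> carrier_vec (xdim S i)" if "k \<in> set [0..<T]" "i \<in> set (subs S)" for i k
      by (rule mult_mat_vec_carrier[OF wc(1)]) (use cw(1) that in auto)
    have Rv: "vcov S i *\<^sub>v cv k i \<in> carrier_vec (ydim S i)" if "k \<in> set [1..<Suc T]" "i \<in> set (subs S)" for i k
      by (rule mult_mat_vec_carrier[OF wc(2)]) (use cv(1) that in \<open>auto simp del: upt_Suc\<close>)
    have "g \<bullet> (diag_block_mat (replicate T (wcovc S)) *\<^sub>v g) =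
        (\<Sum>(i, k)\<in>set (subs S) \<times> set [0..<T]. cw k i \<bullet> (wcov S i *\<^sub>v cw k i))"
    proof -
      have "diag_block_mat (replicate (length [0..<T]) (diag_block_mat (map (wcov S) (subs S)))) *\<^sub>v stack2 cw [0..<T] (subs S) =
          stack2 (\<lambda>k i. wcov S i *\<^sub>v cw k i) [0..<T] (subs S)"
        by (rule diag_block_mat_mult_stack2[where d = "xdim S"]) (use wc cw(1) in auto)
      then have "diag_block_mat (replicate T (wcovc S)) *\<^sub>v g = stack2 (\<lambda>k i. wcov S i *\<^sub>v cw k i) [0..<T] (subs S)"
        by (simp add: cw(2) wcovc_def)
      then show ?thesis
        unfolding cw(2)
        by (simp only:) (rule stack2_scalar_prod[where d = "xdim S"],
            use cw(1) Pw in auto)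
    qed
    moreover have "b \<bullet> (diag_block_mat (replicate T (vcovc S)) *\<^sub>v b) =
        (\<Sum>(i, k)\<in>set (subs S) \<times> set [1..<Suc T]. cv k i \<bullet> (vcov S i *\<^sub>v cv k i))"
    proof -
      have "diag_block_mat (replicate (length [1..<Suc T]) (diag_block_mat (map (vcov S) (subs S)))) *\<^sub>v stack2 cv [1..<Suc T] (subs S) =
          stack2 (\<lambda>k i. vcov S i *\<^sub>v cv k i) [1..<Suc T] (subs S)"
        by (rule diag_block_mat_mult_stack2[where d = "ydim S"]) (use wc cv(1) in \<open>auto simp del: upt_Suc\<close>)
      then have "diag_block_mat (replicate T (vcovc S)) *\<^sub>v b = stack2 (\<lambda>k i. vcov S i *\<^sub>v cv k i) [1..<Suc T] (subs S)"
        by (simp add: cv(2) vcovc_def del: upt_Suc)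
      then show ?thesis
        unfolding cv(2)
        by (simp only:) (rule stack2_scalar_prod[where d = "ydim S"],
            use cv(1) Rv in \<open>auto simp del: upt_Suc\<close>)
    qed
    moreover have "a \<bullet> (Sigmac S T K *\<^sub>v a) =
        g \<bullet> (diag_block_mat (replicate T (wcovc S)) *\<^sub>v g) + b \<bullet> (diag_block_mat (replicate T (vcovc S)) *\<^sub>v b)"
      unfolding Sigmac_def N_def[symmetric]
      by (rule filtered_cov_quad_form[OF Kc N central_carriers(4,5) a b_def g_def])
    ultimately show "a \<bullet> (Sigmac S T K *\<^sub>v a) = (\<Sum>q\<in>horizon_noises T. c q \<bullet> (noise_cov q *\<^sub>v c q))"
      unfolding plus by (simp add: c_def noise_cov_def del: upt_Suc)
  qed
qed

text \<open>The central statistic is the squared length of a whitened Gaussian vector whose dimension is the rank of its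
  invertible covariance matrix, so the lower tail bound applies to a missed detection.\<close>

lemma central_miss_prob:
  assumes ua: "is_attack S ua" and K: "rows_basis_of_left_null_space K (Oc S T)"
    and inv: "invertible_mat (Sigmac S T K)" and x: "0 \<le> x"
    and \<tau>: "\<tau> \<le> real (pc S T K) + lambdac S T K ua - sqrt (4 * (real (pc S T K) + 2 * lambdac S T K ua) * x)"
  shows "1 - alarm_prob_central S T K \<tau> ua \<le> exp (- x)"
proof -
  let ?n = "dim_row K" and ?Z = "\<lambda>\<omega>. K *\<^sub>v Yc S T ua \<omega>"
  note cov = Sigmac_covariance(2)[OF K]
  have Sc: "Sigmac S T K \<in> carrier_mat ?n ?n" using cov by (simp add: covariance_mat_def)
  have J: "horizon_noises T \<subseteq> ({1..nsub S} \<times> UNIV) <+> ({1..nsub S} \<times> UNIV)"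
    by (auto simp: horizon_noises_def)
  have Z: "?Z \<omega> \<in> carrier_vec ?n" for \<omega> by (rule carrier_vecI) simp
  have beta: "betac S T K ua \<in> carrier_vec ?n" by (rule carrier_vecI) (simp add: betac_def)
  have lin: "(\<lambda>\<omega>. a \<bullet> ?Z \<omega>) \<in> borel_measurable (pspace S) \<and>
      (CLINT \<omega>|pspace S. iexp (a \<bullet> ?Z \<omega>)) =
        iexp (a \<bullet> betac S T K ua) * complex_of_real (exp (- ((a \<bullet> (Sigmac S T K *\<^sub>v a)) / 2)))"
    if a: "a \<in> carrier_vec ?n" for a
  proof -
    obtain c where c: "\<And>q. q \<in> horizon_noises T \<Longrightarrow> c q \<in> carrier_vec (noise_dim q)"
      and Zc: "\<And>\<omega>. \<omega> \<in> space (pspace S) \<Longrightarrow>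
        a \<bullet> ?Z \<omega> = a \<bullet> betac S T K ua + (\<Sum>q\<in>horizon_noises T. c q \<bullet> noise q \<omega>)"
      and var: "a \<bullet> (Sigmac S T K *\<^sub>v a) = (\<Sum>q\<in>horizon_noises T. c q \<bullet> (noise_cov q *\<^sub>v c q))"
      using central_functional[OF ua K a] by blast
    have "(\<lambda>\<omega>. a \<bullet> betac S T K ua + (\<Sum>q\<in>horizon_noises T. c q \<bullet> noise q \<omega>)) \<in> borel_measurable (pspace S)"
    proof (intro borel_measurable_add borel_measurable_const borel_measurable_sum)
      fix q assume q: "q \<in> horizon_noises T"
      show "(\<lambda>\<omega>. c q \<bullet> noise q \<omega>) \<in> borel_measurable (pspace S)"
        using noise_gaussian(1)[OF subsetD[OF J q]] c[OF q] by (simp add: gaussian_vec_def)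
    qed
    then have m: "(\<lambda>\<omega>. a \<bullet> ?Z \<omega>) \<in> borel_measurable (pspace S)"
      by (subst measurable_cong[OF Zc])
    have "(CLINT \<omega>|pspace S. iexp (a \<bullet> ?Z \<omega>)) =
        (CLINT \<omega>|pspace S. iexp (a \<bullet> betac S T K ua) * iexp (\<Sum>q\<in>horizon_noises T. c q \<bullet> noise q \<omega>))"
      by (rule Bochner_Integration.integral_cong) (simp_all add: Zc exp_add[symmetric] distrib_left)
    also have "\<dots> = iexp (a \<bullet> betac S T K ua) * (CLINT \<omega>|pspace S. iexp (\<Sum>q\<in>horizon_noises T. c q \<bullet> noise q \<omega>))"
      by (rule integral_mult_right_zero)
    also have "(CLINT \<omega>|pspace S. iexp (\<Sum>q\<in>horizon_noises T. c q \<bullet> noise q \<omega>)) =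
        complex_of_real (exp (- ((a \<bullet> (Sigmac S T K *\<^sub>v a)) / 2)))"
      unfolding var
      by (rule cf_sum_indep_gaussian[OF noise_indep J _ _ c]) (use noise_gaussian J in auto)
    finally show ?thesis using m by blast
  qed
  have "pc S T K = ?n"
  proof -
    obtain W where W: "W \<in> carrier_mat ?n ?n" "W * Sigmac S T K * transpose_mat W = 1\<^sub>m ?n"
      by (rule whitening[OF cov inv])
    have "det (W * Sigmac S T K * transpose_mat W) = det W * det (Sigmac S T K) * det (transpose_mat W)"
      using det_mult[OF mult_carrier_mat[OF W(1) Sc] iffD2[OF transpose_carrier_mat W(1)]] det_mult[OF W(1) Sc]
      by (simp only:)
    then have "det (Sigmac S T K) \<noteq> 0" unfolding W(2) by auto
    then show ?thesis
      unfolding pc_def using vec_space.det_rank_iff[OF Sc] Sc by simp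
  qed
  with \<tau> have \<tau>': "\<tau> \<le> real ?n + lambdac S T K ua - sqrt (4 * (real ?n + 2 * lambdac S T K ua) * x)" by simp
  have bound: "prob {\<omega> \<in> space (pspace S). inv_quad_form (Sigmac S T K) (?Z \<omega>) < \<tau>} \<le> exp (- x)"
    by (rule gaussian_quadratic_form_lower_tail[OF Z _ _ beta cov inv lambdac_def x \<tau>']) (use lin in auto)
  have "Lambdac S T K ua \<in> borel_measurable (pspace S)"
  proof -
    obtain W where W: "W \<in> carrier_mat ?n ?n" "W * Sigmac S T K * transpose_mat W = 1\<^sub>m ?n"
      by (rule whitening[OF cov inv])
    have "Lambdac S T K ua = (\<lambda>\<omega>. \<Sum>j<?n. (row W j \<bullet> ?Z \<omega>)\<^sup>2)"
      using W(1) by (simp add: fun_eq_iff Lambdac_def inv_quad_form_whitened[OF Sc W Z])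
    also have "\<dots> \<in> borel_measurable (pspace S)"
      using lin W(1) by (intro borel_measurable_sum borel_measurable_power) auto
    finally show ?thesis .
  qed
  then have ev: "{\<omega> \<in> space (pspace S). Lambdac S T K ua \<omega> \<ge> \<tau>} \<in> events" by measurable
  have "space (pspace S) - {\<omega> \<in> space (pspace S). Lambdac S T K ua \<omega> \<ge> \<tau>} =
      {\<omega> \<in> space (pspace S). inv_quad_form (Sigmac S T K) (?Z \<omega>) < \<tau>}"
    by (auto simp: Lambdac_def)
  then show ?thesis using prob_compl[OF ev] bound by (simp add: alarm_prob_central_def)
qed

end

section \<open>Comparison of the detectors\<close>

theorem mainTheorem3:
  fixes S :: "'o network" and T :: nat and ua :: attack
    and Nl :: "nat \<Rightarrow> real mat" and Nc :: "real mat"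
    and \<tau> :: "nat \<Rightarrow> real" and \<tau>c :: real and PDmax :: real
  assumes sys: "interconnected_system S"
    and horizon: "0 < T"
    and attack: "is_attack S ua"
    and nontriv_local: "\<And>i. i \<in> {1..nsub S} \<Longrightarrow> left_null_space (OFl S T i) \<noteq> {0\<^sub>v (dim_row (OFl S T i))}"
    and basis_local: "\<And>i. i \<in> {1..nsub S} \<Longrightarrow> rows_basis_of_left_null_space (Nl i) (OFl S T i)"
    and inv_local: "\<And>i. i \<in> {1..nsub S} \<Longrightarrow> invertible_mat (Sigmal S T Nl i)"
    and nontriv_central: "left_null_space (Oc S T) \<noteq> {0\<^sub>v (dim_row (Oc S T))}"
    and basis_central: "rows_basis_of_left_null_space Nc (Oc S T)"
    and inv_central: "invertible_mat (Sigmac S T Nc)"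
    and thr_local: "\<And>i. i \<in> {1..nsub S} \<Longrightarrow> 0 \<le> \<tau> i"
    and thr_central: "0 \<le> \<tau>c"
    and false_alarm: "alarm_prob_central S T Nc \<tau>c (no_attack S)
                    = alarm_prob_decentral S T Nl \<tau> (no_attack S)"
    and PDmax: "PDmax = Max (alarm_prob_local S T Nl \<tau> ua ` {1..nsub S})"
    and PDmax_less: "PDmax < 1"
    and threshold: "\<tau>c \<le> real (pc S T Nc) + lambdac S T Nc ua
          - sqrt (4 * real (nsub S) * (real (pc S T Nc) + 2 * lambdac S T Nc ua)
                  * ln (1 / (1 - PDmax)))"
  shows "alarm_prob_central S T Nc \<tau>c ua \<ge> alarm_prob_decentral S T Nl \<tau> ua"
proof -
  interpret interconnection S by (rule interconnection.intro[OF sys])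
  define x where "x = real (nsub S) * ln (1 / (1 - PDmax))"
  have le: "alarm_prob_local S T Nl \<tau> ua i \<le> PDmax" if "i \<in> {1..nsub S}" for i
    unfolding PDmax using that by (intro Max_ge) auto
  have "1 \<in> {1..nsub S}" using sys by (simp add: interconnected_system_def)
  then have "alarm_prob_local S T Nl \<tau> ua 1 \<le> PDmax" by (rule le)
  moreover have "0 \<le> alarm_prob_local S T Nl \<tau> ua 1"
    unfolding alarm_prob_local_def by (rule measure_nonneg)
  ultimately have "0 \<le> PDmax" by linarith
  then have x: "0 \<le> x" using PDmax_less by (simp add: x_def)
  have exp_x: "exp (- x) = (1 - PDmax) ^ nsub S"
  proof -
    have "- x = real (nsub S) * ln (1 - PDmax)"
      using PDmax_less by (simp add: x_def ln_div)
    then have "exp (- x) = exp (ln (1 - PDmax)) ^ nsub S" by (simp only: exp_of_nat_mult)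
    then show ?thesis using PDmax_less by simp
  qed
  have threshold': "\<tau>c \<le> real (pc S T Nc) + lambdac S T Nc ua -
      sqrt (4 * (real (pc S T Nc) + 2 * lambdac S T Nc ua) * x)"
    using threshold by (simp only: x_def mult_ac)
  have "1 - alarm_prob_central S T Nc \<tau>c ua \<le> exp (- x)"
    by (rule central_miss_prob[OF attack basis_central inv_central x]) (fact threshold')
  also have "\<dots> = (\<Prod>i\<in>{1..nsub S}. 1 - PDmax)" by (simp add: exp_x)
  also have "\<dots> \<le> (\<Prod>i\<in>{1..nsub S}. 1 - alarm_prob_local S T Nl \<tau> ua i)"
    using le PDmax_less by (intro prod_mono) auto
  also have "\<dots> = 1 - alarm_prob_decentral S T Nl \<tau> ua"
    by (rule alarm_prob_decentral_eq[symmetric, OF attack basis_local inv_local])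
  finally show ?thesis by simp
qed

end
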